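(* Let $(M^5,g_\eta,\eta,\xi,J)$ be a $5$-dimensional strictly pseudoconvex CR manifold, regarded as a contact metric manifold, with its canonical spin$^c$-structure, spinor bundle $S=\Lambda_H^{0,*}(M)=\Lambda^{0,0}_H(M)\oplus\Lambda^{0,1}_H(M)\oplus\Lambda^{0,2}_H(M)$ and determinant line bundle $\Lambda_H^{0,2}(M)$. Let $A$ be the unitary connection on $\Lambda_H^{0,2}(M)$ induced by the generalized Tanaka-Webster connection $\nabla$. Suppose that the scalar curvature $s$ of $M$ is constant and negative. Let $\psi_0\in\Gamma(\Lambda_H^{0,0}(M))$ be the spinor corresponding to the constant function $1$, and put $\psi=\sqrt{-s}\,\psi_0$. Then the pair $(A,\psi)$ is a solution of the Seiberg-Witten like equations $$D_A\psi=0,\qquad F_A^+=-\tfrac14\,\sigma(\psi)^+ .$$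
   Context: Contact metric manifold: $\eta$ is a contact form on $M^{5}$ with $H=\ker\eta$, Reeb field $\xi$ ($\eta(\xi)=1$, $d\eta(\xi,\cdot)=0$), $J$ an almost complex structure on $H$ compatible with $d\eta|_H$, extended by $J\xi=0$, and $g_\eta(X,Y)=d\eta(X,JY)+\eta(X)\eta(Y)$ is a Riemannian metric; thus $d\eta(X,Y)=g_\eta(JX,Y)$. Here $d\eta(X,Y)=X\eta(Y)-Y\eta(X)-\eta([X,Y])$. Strictly pseudoconvex CR manifold: a contact metric manifold such that $(H,J|_H)$ is an integrable CR structure, i.e. for $X,Y\in\Gamma(H)$, $[JX,Y]+[X,JY]\in\Gamma(H)$ and $J([JX,Y]+[X,JY])-[JX,JY]+[X,Y]=0$; equivalently $\nabla J=0$ for the generalized Tanaka-Webster connection $\nabla$. In this case $\nabla$ is the unique affine connection on $TM$ with $\nabla\eta=0$, $\nabla\xi=0$, $\nabla g_\eta=0$, $\nabla J=0$, whose torsion $T(X,Y)=\nabla_XY-\nabla_YX-[X,Y]$ satisfies $T(X,Y)=d\eta(X,Y)\xi$ for $X,Y\in\Gamma(H)$ and $T(\xi,\cdot)=-\frac12 J\circ\mathcal L_\xi J$. Curvature: $R(X,Y)=[\nabla_X,\nabla_Y]-\nabla_{[X,Y]}$. For a local orthonormal frame $e_1,\,e_2=Je_1,\,e_3,\,e_4=Je_3$ of $H$, the scalar curvature is $s=\sum_{\alpha,\beta=1}^4 g_\eta(R(e_\beta,e_\alpha)e_\alpha,e_\beta)$. Spinors: extend $g_\eta$ complex bilinearly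 to $TM^{\mathbb C}$; $T^{1,0}M$ and $T^{0,1}M$ are the $i$- and $(-i)$-eigenbundles of $J$ on $H^{\mathbb C}$; $\Lambda_H^{0,q}(M)$ is the bundle of $(0,q)$-forms on $H$ with the induced Hermitian inner product $\langle\cdot,\cdot\rangle$ (complex linear in the first slot), so that the constant function $1\in\Lambda^{0,0}_H(M)$ has norm $1$. Clifford multiplication by a real vector $X$ on a $(0,q)$-form $\alpha$ is $$X\cdot\alpha=\sqrt2\big((X_H^{0,1})^*\wedge\alpha-X_H^{0,1}\lrcorner\,\alpha\big)+(-1)^{q+1}i\,\eta(X)\alpha,$$ where $X_H$ is the horizontal part of $X$, $X_H=X_H^{1,0}+X_H^{0,1}$, and $(X_H^{0,1})^*$ is the Hermitian dual of $X_H^{0,1}$, i.e. the $(0,1)$-form $g_\eta(X_H^{1,0},\cdot)$. Connections: a unitary connection $A$ on the determinant bundle together with $\nabla$ induces a spinorial connection $\nabla^A$ on $S$; for the connection $A$ on $\Lambda_H^{0,2}(M)$ induced by $\nabla$, $\nabla^A$ is the natural extension of $\nabla$ to $\Lambda_H^{0,*}(M)$. The Dirac operator is $D_A=\sum_{i=1}^4 e_i\cdot\nabla^A_{e_i}+\xi\cdot\nabla^A_\xi$. $F_A$ is the curvature of $A$, an $i\mathbb R$-valued $2$-form on $M$. The form $\sigma(\psi)$: for a spinor $\psi$, $\sigma(\psi)(X,Y)=\langle X\cdot Y\cdot\psi,\psi\rangle+g_\eta(X,Y)|\psi|^2$, an imaginary-valued $2$-form. Self-duality: a $2$-form $\alpha$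 splits as $\alpha=\alpha_H+\eta\wedge i(\xi)\alpha$ with $\alpha_H=\alpha\circ\Pi$, where $\Pi:TM\to H$ is the canonical projection (along $\xi$). On horizontal $2$-forms let $\star\beta=*(\eta\wedge\beta)$, where $*$ is the Hodge star of $g_\eta$ for the orientation in which $\eta\wedge e^1\wedge e^2\wedge e^3\wedge e^4$ is positive; then $\star^2=\mathrm{id}$. The self-dual part $\alpha^+$ of $\alpha$ is $\frac12(\alpha_H+\star\alpha_H)$. *)

theory Defs
  imports "HOL-Analysis.Analysis"
begin

section \<open>Smooth manifolds and vector fields\<close>

text \<open>Differentiability of order k on an open set; all iterated directional derivatives are
  required to exist and to be differentiable again.\<close>

fun ck_on :: "nat \<Rightarrow> 'm::real_normed_vector set \<Rightarrow> ('m \<Rightarrow> 'n::real_normed_vector) \<Rightarrow> bool" where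
  "ck_on 0 S f \<longleftrightarrow> continuous_on S f"
| "ck_on (Suc k) S f \<longleftrightarrow>
     (\<forall>x\<in>S. f differentiable (at x)) \<and> (\<forall>v. ck_on k S (\<lambda>x. frechet_derivative f (at x) v))"

definition smooth_on :: "'m::real_normed_vector set \<Rightarrow> ('m \<Rightarrow> 'n::real_normed_vector) \<Rightarrow> bool" where
  "smooth_on S f \<longleftrightarrow> (\<forall>k. ck_on k S f)"

type_synonym 'a chart = "'a set \<times> ('a \<Rightarrow> real ^ 5)"

definition is_chart :: "'a::topological_space chart \<Rightarrow> bool" where
  "is_chart c \<longleftrightarrow> (case c of (U, \<phi>) \<Rightarrow>
     open U \<and> open (\<phi> ` U) \<and> homeomorphism U (\<phi> ` U) \<phi> (inv_into U \<phi>))"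

definition smooth_atlas :: "'a::topological_space chart set \<Rightarrow> bool" where
  "smooth_atlas \<A> \<longleftrightarrow> (\<forall>c\<in>\<A>. is_chart c) \<and> (\<Union>(U, \<phi>)\<in>\<A>. U) = UNIV \<and>
     (\<forall>(U, \<phi>)\<in>\<A>. \<forall>(V, \<psi>)\<in>\<A>. smooth_on (\<phi> ` (U \<inter> V)) (\<psi> \<circ> inv_into U \<phi>))"

text \<open>A vector field is a derivation of the algebra of smooth functions; it is normalised to be
  zero on non-smooth functions, so that HOL equality is equality of vector fields. The value
  at p of the field X is the tangent vector \<open>\<lambda>f. X f p\<close>.
  Complex vector fields are the derivations with values in the complex-valued functions.\<close>

type_synonym 'a vf = "('a \<Rightarrow> real) \<Rightarrow> 'a \<Rightarrow> real"
type_synonym 'a cvf = "('a \<Rightarrow> real) \<Rightarrow> 'a \<Rightarrow> complex"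

text \<open>The tensors \<open>eta\<close> and \<open>cstr\<close> (the endomorphism J) are given by their action on vector
  fields, and only this action is meaningful. They are required to be linear over the smooth
  functions, which is what makes them tensor fields.\<close>

record 'a contact_data =
  atlas :: "'a chart set"
  eta :: "'a vf \<Rightarrow> 'a \<Rightarrow> real"
  reeb :: "'a vf"
  cstr :: "'a vf \<Rightarrow> 'a vf"

definition smooth_fun :: "'a contact_data \<Rightarrow> ('a \<Rightarrow> 'n::real_normed_vector) set" where
  "smooth_fun M = {f. \<forall>(U, \<phi>)\<in>atlas M. smooth_on (\<phi> ` U) (f \<circ> inv_into U \<phi>)}"

definition vadd :: "('f \<Rightarrow> 'a \<Rightarrow> 'b::ring) \<Rightarrow> ('f \<Rightarrow> 'a \<Rightarrow> 'b) \<Rightarrow> 'f \<Rightarrow> 'a \<Rightarrow> 'b" where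
  "vadd X Y = (\<lambda>f p. X f p + Y f p)"

definition vsub :: "('f \<Rightarrow> 'a \<Rightarrow> 'b::ring) \<Rightarrow> ('f \<Rightarrow> 'a \<Rightarrow> 'b) \<Rightarrow> 'f \<Rightarrow> 'a \<Rightarrow> 'b" where
  "vsub X Y = (\<lambda>f p. X f p - Y f p)"

definition vmult :: "('a \<Rightarrow> 'b::ring) \<Rightarrow> ('f \<Rightarrow> 'a \<Rightarrow> 'b) \<Rightarrow> 'f \<Rightarrow> 'a \<Rightarrow> 'b" where
  "vmult h X = (\<lambda>f p. h p * X f p)"

definition vzero :: "'f \<Rightarrow> 'a \<Rightarrow> 'b::ring" where
  "vzero = (\<lambda>f p. 0)"

definition vector_fields :: "'a contact_data \<Rightarrow> 'a vf set" where
  "vector_fields M = {X.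
     (\<forall>f\<in>smooth_fun M. X f \<in> smooth_fun M) \<and>
     (\<forall>f. f \<notin> smooth_fun M \<longrightarrow> X f = (\<lambda>p. 0)) \<and>
     (\<forall>f\<in>smooth_fun M. \<forall>g\<in>smooth_fun M. \<forall>a b p.
        X (\<lambda>q. a * f q + b * g q) p = a * X f p + b * X g p) \<and>
     (\<forall>f\<in>smooth_fun M. \<forall>g\<in>smooth_fun M. \<forall>p.
        X (\<lambda>q. f q * g q) p = X f p * g p + f p * X g p)}"

definition bracket :: "'a vf \<Rightarrow> 'a vf \<Rightarrow> 'a vf" where
  "bracket X Y = (\<lambda>f p. X (Y f) p - Y (X f) p)"

section \<open>Contact metric and strictly pseudoconvex CR manifolds\<close>

definition horizontal_fields :: "'a contact_data \<Rightarrow> 'a vf set" where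
  "horizontal_fields M = {X \<in> vector_fields M. \<forall>p. eta M X p = 0}"

definition deta :: "'a contact_data \<Rightarrow> 'a vf \<Rightarrow> 'a vf \<Rightarrow> 'a \<Rightarrow> real" where
  "deta M X Y p = X (eta M Y) p - Y (eta M X) p - eta M (bracket X Y) p"

definition metric :: "'a contact_data \<Rightarrow> 'a vf \<Rightarrow> 'a vf \<Rightarrow> 'a \<Rightarrow> real" where
  "metric M X Y p = deta M X (cstr M Y) p + eta M X p * eta M Y p"

definition is_one_form :: "'a contact_data \<Rightarrow> ('a vf \<Rightarrow> 'a \<Rightarrow> real) \<Rightarrow> bool" where
  "is_one_form M \<theta> \<longleftrightarrow>
     (\<forall>X\<in>vector_fields M. \<theta> X \<in> smooth_fun M) \<and>
     (\<forall>X\<in>vector_fields M. \<forall>Y\<in>vector_fields M. \<forall>p. \<theta> (vadd X Y) p = \<theta> X p + \<theta> Y p) \<and>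
     (\<forall>X\<in>vector_fields M. \<forall>h\<in>smooth_fun M. \<forall>p. \<theta> (vmult h X) p = h p * \<theta> X p)"

definition is_endomorphism :: "'a contact_data \<Rightarrow> ('a vf \<Rightarrow> 'a vf) \<Rightarrow> bool" where
  "is_endomorphism M L \<longleftrightarrow>
     (\<forall>X\<in>vector_fields M. L X \<in> vector_fields M) \<and>
     (\<forall>X\<in>vector_fields M. \<forall>Y\<in>vector_fields M. L (vadd X Y) = vadd (L X) (L Y)) \<and>
     (\<forall>X\<in>vector_fields M. \<forall>h\<in>smooth_fun M. L (vmult h X) = vmult h (L X))"

text \<open>Up to a nonzero constant this is the value of \<open>\<eta> \<and> d\<eta> \<and> d\<eta>\<close> on five fields.\<close>

definition contact_volume :: "'a contact_data \<Rightarrow> (nat \<Rightarrow> 'a vf) \<Rightarrow> 'a \<Rightarrow> real" where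
  "contact_volume M X p = (\<Sum>\<pi> | \<pi> permutes {..<5}. of_int (sign \<pi>) *
     (eta M (X (\<pi> 0)) p * deta M (X (\<pi> 1)) (X (\<pi> 2)) p * deta M (X (\<pi> 3)) (X (\<pi> 4)) p))"

definition is_contact_form :: "'a contact_data \<Rightarrow> bool" where
  "is_contact_form M \<longleftrightarrow> is_one_form M (eta M) \<and>
     (\<forall>p. \<exists>X. (\<forall>i<5. X i \<in> vector_fields M) \<and> contact_volume M X p \<noteq> 0)"

definition is_riemannian :: "'a contact_data \<Rightarrow> ('a vf \<Rightarrow> 'a vf \<Rightarrow> 'a \<Rightarrow> real) \<Rightarrow> bool" where
  "is_riemannian M g \<longleftrightarrow>
     (\<forall>X\<in>vector_fields M. is_one_form M (g X)) \<and>
     (\<forall>X\<in>vector_fields M. \<forall>Y\<in>vector_fields M. \<forall>p. g X Y p = g Y X p) \<and>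
     (\<forall>X\<in>vector_fields M. \<forall>p. 0 \<le> g X X p \<and> (g X X p = 0 \<longleftrightarrow> (\<forall>f. X f p = 0)))"

definition contact_metric_manifold ::
  "'a::{t2_space,second_countable_topology} contact_data \<Rightarrow> bool" where
  "contact_metric_manifold M \<longleftrightarrow>
     smooth_atlas (atlas M) \<and> is_contact_form M \<and>
     reeb M \<in> vector_fields M \<and> (\<forall>p. eta M (reeb M) p = 1) \<and>
     (\<forall>X\<in>vector_fields M. \<forall>p. deta M (reeb M) X p = 0) \<and>
     is_endomorphism M (cstr M) \<and> cstr M (reeb M) = vzero \<and>
     (\<forall>X\<in>horizontal_fields M. cstr M X \<in> horizontal_fields M \<and>
        cstr M (cstr M X) = vsub vzero X) \<and>
     (\<forall>X\<in>horizontal_fields M. \<forall>Y\<in>horizontal_fields M. \<forall>p.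
        deta M (cstr M X) (cstr M Y) p = deta M X Y p) \<and>
     is_riemannian M (metric M)"

definition strictly_pseudoconvex_CR ::
  "'a::{t2_space,second_countable_topology} contact_data \<Rightarrow> bool" where
  "strictly_pseudoconvex_CR M \<longleftrightarrow> contact_metric_manifold M \<and>
     (\<forall>X\<in>horizontal_fields M. \<forall>Y\<in>horizontal_fields M.
        (let B = vadd (bracket (cstr M X) Y) (bracket X (cstr M Y)) in
         B \<in> horizontal_fields M \<and>
         vadd (vsub (cstr M B) (bracket (cstr M X) (cstr M Y))) (bracket X Y) = vzero))"

section \<open>The generalized Tanaka-Webster connection\<close>

type_synonym 'a connection = "'a vf \<Rightarrow> 'a vf \<Rightarrow> 'a vf"

definition affine_connection :: "'a contact_data \<Rightarrow> 'a connection \<Rightarrow> bool" where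
  "affine_connection M nabla \<longleftrightarrow>
     (\<forall>X\<in>vector_fields M. \<forall>Y\<in>vector_fields M. nabla X Y \<in> vector_fields M) \<and>
     (\<forall>X\<in>vector_fields M. \<forall>X'\<in>vector_fields M. \<forall>Y\<in>vector_fields M.
        nabla (vadd X X') Y = vadd (nabla X Y) (nabla X' Y)) \<and>
     (\<forall>X\<in>vector_fields M. \<forall>Y\<in>vector_fields M. \<forall>h\<in>smooth_fun M.
        nabla (vmult h X) Y = vmult h (nabla X Y)) \<and>
     (\<forall>X\<in>vector_fields M. \<forall>Y\<in>vector_fields M. \<forall>Y'\<in>vector_fields M.
        nabla X (vadd Y Y') = vadd (nabla X Y) (nabla X Y')) \<and>
     (\<forall>X\<in>vector_fields M. \<forall>Y\<in>vector_fields M. \<forall>h\<in>smooth_fun M.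
        nabla X (vmult h Y) = vadd (vmult (X h) Y) (vmult h (nabla X Y)))"

definition torsion :: "'a connection \<Rightarrow> 'a vf \<Rightarrow> 'a vf \<Rightarrow> 'a vf" where
  "torsion nabla X Y = vsub (vsub (nabla X Y) (nabla Y X)) (bracket X Y)"

definition curv :: "'a connection \<Rightarrow> 'a vf \<Rightarrow> 'a vf \<Rightarrow> 'a vf \<Rightarrow> 'a vf" where
  "curv nabla X Y Z =
     vsub (vsub (nabla X (nabla Y Z)) (nabla Y (nabla X Z))) (nabla (bracket X Y) Z)"

text \<open>The clauses express that \<open>\<eta>\<close>, \<open>\<xi>\<close>, the metric and J are parallel, followed by
  the torsion of horizontal fields and \<open>T(\<xi>, Y) = - (1/2) J ((L\<^sub>\<xi> J) Y)\<close> with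
  \<open>(L\<^sub>\<xi> J) Y = [\<xi>, J Y] - J [\<xi>, Y]\<close>.\<close>

definition tanaka_webster :: "'a contact_data \<Rightarrow> 'a connection \<Rightarrow> bool" where
  "tanaka_webster M nabla \<longleftrightarrow> affine_connection M nabla \<and>
     (\<forall>X\<in>vector_fields M. \<forall>Y\<in>vector_fields M. \<forall>p.
        X (eta M Y) p = eta M (nabla X Y) p) \<and>
     (\<forall>X\<in>vector_fields M. nabla X (reeb M) = vzero) \<and>
     (\<forall>X\<in>vector_fields M. \<forall>Y\<in>vector_fields M. \<forall>Z\<in>vector_fields M. \<forall>p.
        X (metric M Y Z) p = metric M (nabla X Y) Z p + metric M Y (nabla X Z) p) \<and>
     (\<forall>X\<in>vector_fields M. \<forall>Y\<in>vector_fields M. nabla X (cstr M Y) = cstr M (nabla X Y)) \<and>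
     (\<forall>X\<in>horizontal_fields M. \<forall>Y\<in>horizontal_fields M.
        torsion nabla X Y = vmult (deta M X Y) (reeb M)) \<and>
     (\<forall>Y\<in>vector_fields M. torsion nabla (reeb M) Y =
        vmult (\<lambda>p. - 1 / 2)
          (cstr M (vsub (bracket (reeb M) (cstr M Y)) (cstr M (bracket (reeb M) Y)))))"

text \<open>A local orthonormal frame \<open>E 1, E 2 = J (E 1), E 3, E 4 = J (E 3)\<close> of H on the open set
  U. The fields are globally defined and the frame conditions hold on U; every local frame
  has this form after shrinking U. By convention \<open>E 0\<close> is the Reeb field.\<close>

definition adapted_frame ::
  "'a::topological_space contact_data \<Rightarrow> 'a set \<Rightarrow> (nat \<Rightarrow> 'a vf) \<Rightarrow> bool" where
  "adapted_frame M U E \<longleftrightarrow> open U \<and> E 0 = reeb M \<and>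
     (\<forall>i\<in>{1..4}. E i \<in> horizontal_fields M) \<and>
     E 2 = cstr M (E 1) \<and> E 4 = cstr M (E 3) \<and>
     (\<forall>p\<in>U. \<forall>i\<in>{1..4}. \<forall>j\<in>{1..4}. metric M (E i) (E j) p = (if i = j then 1 else 0)) \<and>
     (\<forall>p\<in>U. \<forall>X\<in>horizontal_fields M. \<exists>c. \<forall>f. X f p = (\<Sum>i=1..4. c i * E i f p))"

definition has_scalar_curvature ::
  "'a::topological_space contact_data \<Rightarrow> 'a connection \<Rightarrow> ('a \<Rightarrow> real) \<Rightarrow> bool" where
  "has_scalar_curvature M nabla s \<longleftrightarrow> (\<forall>U E. adapted_frame M U E \<longrightarrow> (\<forall>p\<in>U.
     s p = (\<Sum>a=1..4. \<Sum>b=1..4. metric M (curv nabla (E b) (E a) (E a)) (E b) p)))"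

section \<open>Complexification and forms of type (0,q)\<close>

definition re_vf :: "'a cvf \<Rightarrow> 'a vf" where
  "re_vf Z = (\<lambda>f p. Re (Z f p))"

definition im_vf :: "'a cvf \<Rightarrow> 'a vf" where
  "im_vf Z = (\<lambda>f p. Im (Z f p))"

definition complex_vf :: "'a vf \<Rightarrow> 'a vf \<Rightarrow> 'a cvf" where
  "complex_vf X Y = (\<lambda>f p. Complex (X f p) (Y f p))"

text \<open>A real vector field applied to a complex-valued function.\<close>

definition cderiv :: "'a vf \<Rightarrow> ('a \<Rightarrow> complex) \<Rightarrow> 'a \<Rightarrow> complex" where
  "cderiv X u p = Complex (X (\<lambda>q. Re (u q)) p) (X (\<lambda>q. Im (u q)) p)"

definition cmetric :: "'a contact_data \<Rightarrow> 'a cvf \<Rightarrow> 'a cvf \<Rightarrow> 'a \<Rightarrow> complex" where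
  "cmetric M Z W p =
     Complex (metric M (re_vf Z) (re_vf W) p - metric M (im_vf Z) (im_vf W) p)
             (metric M (re_vf Z) (im_vf W) p + metric M (im_vf Z) (re_vf W) p)"

definition cnabla :: "'a connection \<Rightarrow> 'a vf \<Rightarrow> 'a cvf \<Rightarrow> 'a cvf" where
  "cnabla nabla X Z = complex_vf (nabla X (re_vf Z)) (nabla X (im_vf Z))"

definition cJ :: "'a contact_data \<Rightarrow> 'a cvf \<Rightarrow> 'a cvf" where
  "cJ M Z = complex_vf (cstr M (re_vf Z)) (cstr M (im_vf Z))"

text \<open>Sections of \<open>H \<otimes> \<complex>\<close> and of its subbundle of type (1,0).\<close>

definition HC :: "'a contact_data \<Rightarrow> 'a cvf set" where
  "HC M = {Z. re_vf Z \<in> horizontal_fields M \<and> im_vf Z \<in> horizontal_fields M}"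

definition T10 :: "'a contact_data \<Rightarrow> 'a cvf set" where
  "T10 M = {Z \<in> HC M. cJ M Z = vmult (\<lambda>p. \<i>) Z}"

definition hproj :: "'a contact_data \<Rightarrow> 'a vf \<Rightarrow> 'a vf" where
  "hproj M X = vsub X (vmult (eta M X) (reeb M))"

text \<open>\<open>X\<^sub>H = part10 X + part01 X\<close> with \<open>part10 X = (X\<^sub>H - i J X\<^sub>H)/2\<close>.\<close>

definition part10 :: "'a contact_data \<Rightarrow> 'a vf \<Rightarrow> 'a cvf" where
  "part10 M X = vmult (\<lambda>p. 1 / 2)
     (complex_vf (hproj M X) (vsub vzero (cstr M (hproj M X))))"

definition part01 :: "'a contact_data \<Rightarrow> 'a vf \<Rightarrow> 'a cvf" where
  "part01 M X = vmult (\<lambda>p. 1 / 2) (complex_vf (hproj M X) (cstr M (hproj M X)))"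

text \<open>Forms of type (0,q) on H: complex multilinear forms on \<open>H \<otimes> \<complex>\<close>, alternating, and
  zero as soon as one argument is of type (1,0). As forms they are determined by their
  values on \<open>HC M\<close>; other arguments are irrelevant.\<close>

definition clinear_on_HC :: "'a contact_data \<Rightarrow> ('a cvf \<Rightarrow> 'a \<Rightarrow> complex) \<Rightarrow> bool" where
  "clinear_on_HC M \<alpha> \<longleftrightarrow>
     (\<forall>Z\<in>HC M. \<alpha> Z \<in> smooth_fun M) \<and>
     (\<forall>Z\<in>HC M. \<forall>W\<in>HC M. \<forall>p. \<alpha> (vadd Z W) p = \<alpha> Z p + \<alpha> W p) \<and>
     (\<forall>Z\<in>HC M. \<forall>u\<in>smooth_fun M. \<forall>p. \<alpha> (vmult u Z) p = u p * \<alpha> Z p)"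

definition forms01 :: "'a contact_data \<Rightarrow> ('a cvf \<Rightarrow> 'a \<Rightarrow> complex) set" where
  "forms01 M = {\<alpha>. clinear_on_HC M \<alpha> \<and> (\<forall>Z\<in>T10 M. \<forall>p. \<alpha> Z p = 0)}"

definition forms02 :: "'a contact_data \<Rightarrow> ('a cvf \<Rightarrow> 'a cvf \<Rightarrow> 'a \<Rightarrow> complex) set" where
  "forms02 M = {\<omega>. (\<forall>Z\<in>HC M. clinear_on_HC M (\<omega> Z)) \<and>
     (\<forall>Z\<in>HC M. \<forall>W\<in>HC M. \<forall>p. \<omega> Z W p = - \<omega> W Z p) \<and>
     (\<forall>Z\<in>T10 M. \<forall>W\<in>HC M. \<forall>p. \<omega> Z W p = 0)}"

section \<open>Spinors\<close>

record 'a spinor =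
  sp0 :: "'a \<Rightarrow> complex"
  sp1 :: "'a cvf \<Rightarrow> 'a \<Rightarrow> complex"
  sp2 :: "'a cvf \<Rightarrow> 'a cvf \<Rightarrow> 'a \<Rightarrow> complex"

definition spinor_fields :: "'a contact_data \<Rightarrow> 'a spinor set" where
  "spinor_fields M = {\<phi>. sp0 \<phi> \<in> smooth_fun M \<and> sp1 \<phi> \<in> forms01 M \<and> sp2 \<phi> \<in> forms02 M}"

definition sp_add :: "'a spinor \<Rightarrow> 'a spinor \<Rightarrow> 'a spinor" where
  "sp_add \<phi> \<psi> = \<lparr>
     sp0 = (\<lambda>p. sp0 \<phi> p + sp0 \<psi> p),
     sp1 = (\<lambda>Z p. sp1 \<phi> Z p + sp1 \<psi> Z p),
     sp2 = (\<lambda>Z W p. sp2 \<phi> Z W p + sp2 \<psi> Z W p)\<rparr>"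

definition sp_scale :: "('a \<Rightarrow> complex) \<Rightarrow> 'a spinor \<Rightarrow> 'a spinor" where
  "sp_scale u \<phi> = \<lparr>
     sp0 = (\<lambda>p. u p * sp0 \<phi> p),
     sp1 = (\<lambda>Z p. u p * sp1 \<phi> Z p),
     sp2 = (\<lambda>Z W p. u p * sp2 \<phi> Z W p)\<rparr>"

definition unit_spinor :: "'a spinor" where
  "unit_spinor = \<lparr>sp0 = (\<lambda>p. 1), sp1 = (\<lambda>Z p. 0), sp2 = (\<lambda>Z W p. 0)\<rparr>"

definition sp_zero_at :: "'a contact_data \<Rightarrow> 'a spinor \<Rightarrow> 'a \<Rightarrow> bool" where
  "sp_zero_at M \<phi> p \<longleftrightarrow> sp0 \<phi> p = 0 \<and> (\<forall>Z\<in>HC M. sp1 \<phi> Z p = 0) \<and>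
     (\<forall>Z\<in>HC M. \<forall>W\<in>HC M. sp2 \<phi> Z W p = 0)"

text \<open>Clifford multiplication. The Hermitian dual of \<open>X\<^sub>H\<^sup>0\<^sup>,\<^sup>1\<close> is
  \<open>cmetric M (part10 M X)\<close>; the last summand of each component is
  \<open>(-1)^(q+1) i \<eta>(X)\<close> times the component of degree q.\<close>

definition clifford :: "'a contact_data \<Rightarrow> 'a vf \<Rightarrow> 'a spinor \<Rightarrow> 'a spinor" where
  "clifford M X \<phi> = \<lparr>
     sp0 = (\<lambda>p. - complex_of_real (sqrt 2) * sp1 \<phi> (part01 M X) p
              - \<i> * complex_of_real (eta M X p) * sp0 \<phi> p),
     sp1 = (\<lambda>Z p. complex_of_real (sqrt 2) *
                (sp0 \<phi> p * cmetric M (part10 M X) Z p - sp2 \<phi> (part01 M X) Z p)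
              + \<i> * complex_of_real (eta M X p) * sp1 \<phi> Z p),
     sp2 = (\<lambda>Z W p. complex_of_real (sqrt 2) *
                (cmetric M (part10 M X) Z p * sp1 \<phi> W p - cmetric M (part10 M X) W p * sp1 \<phi> Z p)
              - \<i> * complex_of_real (eta M X p) * sp2 \<phi> Z W p)\<rparr>"

text \<open>The Hermitian inner product induced on forms of type (0,q), computed in the unitary frame
  \<open>(E 1 + i E 2)/\<surd>2, (E 3 + i E 4)/\<surd>2\<close> of the (0,1)-bundle.\<close>

definition ubar :: "(nat \<Rightarrow> 'a vf) \<Rightarrow> nat \<Rightarrow> 'a cvf" where
  "ubar E j = vmult (\<lambda>p. 1 / complex_of_real (sqrt 2)) (complex_vf (E (2 * j - 1)) (E (2 * j)))"

definition sp_inner :: "(nat \<Rightarrow> 'a vf) \<Rightarrow> 'a spinor \<Rightarrow> 'a spinor \<Rightarrow> 'a \<Rightarrow> complex" where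
  "sp_inner E \<phi> \<psi> p =
     sp0 \<phi> p * cnj (sp0 \<psi> p)
     + (\<Sum>j\<in>{1,2}. sp1 \<phi> (ubar E j) p * cnj (sp1 \<psi> (ubar E j) p))
     + sp2 \<phi> (ubar E 1) (ubar E 2) p * cnj (sp2 \<psi> (ubar E 1) (ubar E 2) p)"

section \<open>Induced connections, Dirac operator and curvature form\<close>

definition conn01 ::
  "'a connection \<Rightarrow> 'a vf \<Rightarrow> ('a cvf \<Rightarrow> 'a \<Rightarrow> complex) \<Rightarrow> 'a cvf \<Rightarrow> 'a \<Rightarrow> complex" where
  "conn01 nabla X \<alpha> = (\<lambda>Z p. cderiv X (\<alpha> Z) p - \<alpha> (cnabla nabla X Z) p)"

text \<open>The connection A on the determinant bundle induced by \<open>nabla\<close>.\<close>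

definition det_conn ::
  "'a connection \<Rightarrow> 'a vf \<Rightarrow> ('a cvf \<Rightarrow> 'a cvf \<Rightarrow> 'a \<Rightarrow> complex) \<Rightarrow> 'a cvf \<Rightarrow> 'a cvf \<Rightarrow> 'a \<Rightarrow> complex"
  where
  "det_conn nabla X \<omega> = (\<lambda>Z W p.
     cderiv X (\<omega> Z W) p - \<omega> (cnabla nabla X Z) W p - \<omega> Z (cnabla nabla X W) p)"

definition spin_conn :: "'a connection \<Rightarrow> 'a vf \<Rightarrow> 'a spinor \<Rightarrow> 'a spinor" where
  "spin_conn nabla X \<phi> = \<lparr>
     sp0 = cderiv X (sp0 \<phi>),
     sp1 = conn01 nabla X (sp1 \<phi>),
     sp2 = det_conn nabla X (sp2 \<phi>)\<rparr>"

text \<open>The Dirac operator in a local frame; the last summand is the Reeb direction.\<close>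

definition dirac ::
  "'a contact_data \<Rightarrow> 'a connection \<Rightarrow> (nat \<Rightarrow> 'a vf) \<Rightarrow> 'a spinor \<Rightarrow> 'a spinor" where
  "dirac M nabla E \<phi> =
     (let D = (\<lambda>X. clifford M X (spin_conn nabla X \<phi>)) in
      sp_add (D (E 1)) (sp_add (D (E 2)) (sp_add (D (E 3)) (sp_add (D (E 4)) (D (reeb M))))))"

text \<open>The curvature 2-form of a connection A on the determinant bundle: the scalar by which
  the curvature endomorphism of the line bundle acts at the point p.\<close>

definition line_curv ::
  "'a contact_data
     \<Rightarrow> ('a vf \<Rightarrow> ('a cvf \<Rightarrow> 'a cvf \<Rightarrow> 'a \<Rightarrow> complex) \<Rightarrow> 'a cvf \<Rightarrow> 'a cvf \<Rightarrow> 'a \<Rightarrow> complex)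
     \<Rightarrow> 'a vf \<Rightarrow> 'a vf \<Rightarrow> 'a \<Rightarrow> complex" where
  "line_curv M A X Y p = (THE c. \<forall>\<omega>\<in>forms02 M. \<forall>Z\<in>HC M. \<forall>W\<in>HC M.
     A X (A Y \<omega>) Z W p - A Y (A X \<omega>) Z W p - A (bracket X Y) \<omega> Z W p = c * \<omega> Z W p)"

section \<open>The form of a spinor and self-duality\<close>

definition sigma_form ::
  "'a contact_data \<Rightarrow> (nat \<Rightarrow> 'a vf) \<Rightarrow> 'a spinor \<Rightarrow> 'a vf \<Rightarrow> 'a vf \<Rightarrow> 'a \<Rightarrow> complex" where
  "sigma_form M E \<phi> X Y p =
     sp_inner E (clifford M X (clifford M Y \<phi>)) \<phi> p
     + complex_of_real (metric M X Y p) * sp_inner E \<phi> \<phi> p"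

definition hpart ::
  "'a contact_data \<Rightarrow> ('a vf \<Rightarrow> 'a vf \<Rightarrow> 'a \<Rightarrow> complex) \<Rightarrow> 'a vf \<Rightarrow> 'a vf \<Rightarrow> 'a \<Rightarrow> complex" where
  "hpart M \<beta> = (\<lambda>X Y. \<beta> (hproj M X) (hproj M Y))"

definition eta_wedge ::
  "'a contact_data \<Rightarrow> ('a vf \<Rightarrow> 'a vf \<Rightarrow> 'a \<Rightarrow> complex) \<Rightarrow> 'a vf \<Rightarrow> 'a vf \<Rightarrow> 'a vf \<Rightarrow> 'a \<Rightarrow> complex"
  where
  "eta_wedge M \<beta> = (\<lambda>X Y Z p.
     complex_of_real (eta M X p) * \<beta> Y Z p + complex_of_real (eta M Y p) * \<beta> Z X p
     + complex_of_real (eta M Z p) * \<beta> X Y p)"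

text \<open>The volume form \<open>\<eta> \<and> e\<^sup>1 \<and> e\<^sup>2 \<and> e\<^sup>3 \<and> e\<^sup>4\<close>, where \<open>\<eta>\<close> is the metric dual
  of \<open>E 0\<close> and \<open>e\<^sup>i\<close> that of \<open>E i\<close>.\<close>

definition vol_form ::
  "'a contact_data \<Rightarrow> (nat \<Rightarrow> 'a vf) \<Rightarrow> 'a vf list \<Rightarrow> 'a \<Rightarrow> real" where
  "vol_form M E Xs p = (\<Sum>\<pi> | \<pi> permutes {..<5}.
     of_int (sign \<pi>) * (\<Prod>i<5. metric M (E i) (Xs ! \<pi> i) p))"

text \<open>Hodge star of a 3-form \<open>\<gamma>\<close>: contraction with the volume form,
  \<open>(*\<gamma>)(X, Y) = \<Sum>\<^bsub>a<b<c\<^esub> \<gamma>(E a, E b, E c) vol(E a, E b, E c, X, Y)\<close>.\<close>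

definition hodge3 ::
  "'a contact_data \<Rightarrow> (nat \<Rightarrow> 'a vf) \<Rightarrow> ('a vf \<Rightarrow> 'a vf \<Rightarrow> 'a vf \<Rightarrow> 'a \<Rightarrow> complex)
     \<Rightarrow> 'a vf \<Rightarrow> 'a vf \<Rightarrow> 'a \<Rightarrow> complex" where
  "hodge3 M E \<gamma> = (\<lambda>X Y p. \<Sum>c<5. \<Sum>b<c. \<Sum>a<b.
     \<gamma> (E a) (E b) (E c) p * complex_of_real (vol_form M E [E a, E b, E c, X, Y] p))"

definition star ::
  "'a contact_data \<Rightarrow> (nat \<Rightarrow> 'a vf) \<Rightarrow> ('a vf \<Rightarrow> 'a vf \<Rightarrow> 'a \<Rightarrow> complex)
     \<Rightarrow> 'a vf \<Rightarrow> 'a vf \<Rightarrow> 'a \<Rightarrow> complex" where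
  "star M E \<beta> = hodge3 M E (eta_wedge M \<beta>)"

definition selfdual_part ::
  "'a contact_data \<Rightarrow> (nat \<Rightarrow> 'a vf) \<Rightarrow> ('a vf \<Rightarrow> 'a vf \<Rightarrow> 'a \<Rightarrow> complex)
     \<Rightarrow> 'a vf \<Rightarrow> 'a vf \<Rightarrow> 'a \<Rightarrow> complex" where
  "selfdual_part M E \<beta> = (\<lambda>X Y p. (hpart M \<beta> X Y p + star M E (hpart M \<beta>) X Y p) / 2)"

text \<open>The Seiberg-Witten like equations for A induced by \<open>nabla\<close>. The Dirac operator, the
  Hermitian product and the Hodge star do not depend on the adapted frame; each equation is
  required at every point in every adapted frame around it.\<close>

definition seiberg_witten_solution ::
  "'a::topological_space contact_data \<Rightarrow> 'a connection \<Rightarrow> 'a spinor \<Rightarrow> bool" where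
  "seiberg_witten_solution M nabla \<phi> \<longleftrightarrow> \<phi> \<in> spinor_fields M \<and>
     (\<forall>U E. adapted_frame M U E \<longrightarrow> (\<forall>p\<in>U.
        sp_zero_at M (dirac M nabla E \<phi>) p \<and>
        (\<forall>X\<in>vector_fields M. \<forall>Y\<in>vector_fields M.
           selfdual_part M E (line_curv M (det_conn nabla)) X Y p
           = - (1 / 4) * selfdual_part M E (sigma_form M E \<phi>) X Y p)))"

end

theory Submission
  imports Defs "HOL-Real_Asymp.Real_Asymp"
begin

text \<open>The constant spinor is parallel, hence harmonic, and a direct computation of Clifford products
  gives \<open>\<sigma>(\<psi>) = i s d\<eta>\<close> on H, which is self-dual. The curvature of the determinant bundle is
  \<open>F = i \<rho>\<close> with \<open>\<rho>(X, Y) = g(R(X,Y) e\<^sub>1, e\<^sub>2) + g(R(X,Y) e\<^sub>3, e\<^sub>4)\<close>. The first Bianchi identity for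
  the Tanaka-Webster connection shows that \<open>\<rho>\<close> is J-invariant on H with
  \<open>\<rho>(e\<^sub>1, e\<^sub>2) + \<rho>(e\<^sub>3, e\<^sub>4) = - s/2\<close>; the torsion terms drop out because \<open>T(\<xi>, \<cdot>)\<close> is symmetric and
  anticommutes with J. Hence \<open>F\<^sup>+ = - (i s/4) d\<eta>\<close>.

  Tensor fields here act on globally defined fields, so evaluating them pointwise in a local frame
  needs smooth bump functions.\<close>

text \<open>Origin of the constants. Write eij for the wedge of the i-th and j-th dual frame
  covectors. Since \<open>E 2 = J (E 1)\<close> and \<open>E 4 = J (E 3)\<close>, the horizontal
  form d\<eta> is e12 + e34, and the self-dual horizontal forms are spanned by e12 + e34, e13 - e24
  and e14 + e23. The last two change sign under J, so a J-invariant form has self-dual part a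
  multiple of d\<eta>, with factor half the sum of its values on (e1, e2) and (e3, e4). Half of -
  s/2 is the - s/4 in the curvature; on the other side \<sigma> is - i |\<psi>|^2 d\<eta>, and this
  forces |\<psi>|^2 = - s.

  The curvature of the determinant bundle is a definite description quantified over global forms of
  type (0,2). It pins down a value at p only if some such form is nonzero there. The frame fields
  are global, so a wedge of two forms \<open>dual01\<close> supplies one. Conversely, all
  (0,2)-forms are proportional at p, so the curvature endomorphism is read off from its value on a
  single pair of frame vectors.\<close>

subsection \<open>Functions of class \<open>C\<^sup>k\<close>\<close>

text \<open>As \<open>S\<close> is open, the derivative at a point of \<open>S\<close> sees only
  values in \<open>S\<close>, so agreement on \<open>S\<close> passes to derivatives.\<close>

lemma ck_on_cong:
  assumes "open S" "\<And>x. x \<in> S \<Longrightarrow> f x = g x" "ck_on k S f"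
  shows "ck_on k S g"
  using assms(2,3)
proof (induction k arbitrary: f g)
  case 0
  then show ?case by (simp cong: continuous_on_cong)
next
  case (Suc k)
  have d: "(g has_derivative frechet_derivative f (at x)) (at x)" if "x \<in> S" for x
  proof (rule has_derivative_transform_within_open[OF _ \<open>open S\<close> that])
    show "(f has_derivative frechet_derivative f (at x)) (at x)"
      using Suc.prems(2) that by (simp add: frechet_derivative_works[symmetric])
  qed (use Suc.prems in auto)
  then have e: "frechet_derivative g (at x) = frechet_derivative f (at x)" if "x \<in> S" for x
    using frechet_derivative_at[symmetric] that by blast
  show ?case
    using d e Suc.prems(2) Suc.IH[where f="\<lambda>x. frechet_derivative f (at x) v"
        and g="\<lambda>x. frechet_derivative g (at x) v" for v]
    by (auto simp: differentiable_def)
qed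

text \<open>Lets an explicit derivative replace the choice-based \<open>frechet_derivative\<close>
  in the inductions below.\<close>

lemma ck_on_SucI:
  assumes "open S" "\<And>x. x \<in> S \<Longrightarrow> (f has_derivative f' x) (at x)"
    and "\<And>v. ck_on k S (\<lambda>x. f' x v)"
  shows "ck_on (Suc k) S f"
proof -
  have e: "frechet_derivative f (at x) = f' x" if "x \<in> S" for x
    using frechet_derivative_at[OF assms(2)[OF that]] by simp
  show ?thesis
    using assms(2) e ck_on_cong[OF assms(1) _ assms(3)] by (auto simp: differentiable_def)
qed

lemma ck_on_Suc_has_derivative:
  "ck_on (Suc k) S f \<Longrightarrow> x \<in> S \<Longrightarrow> (f has_derivative frechet_derivative f (at x)) (at x)"
  by (simp add: frechet_derivative_works[symmetric])

lemma ck_on_SucD: "ck_on (Suc k) S f \<Longrightarrow> ck_on k S f"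
proof (induction k arbitrary: f)
  case 0
  then show ?case
    by (auto simp: differentiable_imp_continuous_within intro: continuous_at_imp_continuous_on)
next
  case (Suc k)
  then show ?case by (auto simp del: ck_on.simps(2) simp: ck_on.simps(2)[of "Suc k"] ck_on.simps(2)[of k])
qed

text \<open>Serves to glue a bump function to its extension by zero; openness matters for the
  continuity in the base case, differentiability being a pointwise condition.\<close>

lemma ck_on_union:
  assumes "ck_on k S f" "ck_on k T f" "open S" "open T"
  shows "ck_on k (S \<union> T) f"
  using assms(1,2)
  by (induction k arbitrary: f) (auto intro: continuous_on_open_Un assms(3,4))

lemma ck_on_const: "ck_on k S (\<lambda>x. c)"
proof (induction k arbitrary: c)
  case (Suc k)
  then show ?case by (simp add: frechet_derivative_const)
qed simp

lemma ck_on_linear: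
  assumes "bounded_linear L" "open S" "ck_on k S f"
  shows "ck_on k S (\<lambda>x. L (f x))"
  using assms(3)
proof (induction k arbitrary: f)
  case 0
  then show ?case using assms(1) by (auto intro: bounded_linear.continuous_on)
next
  case (Suc k)
  show ?case
  proof (rule ck_on_SucI[OF assms(2)])
    show "((\<lambda>x. L (f x)) has_derivative (\<lambda>v. L (frechet_derivative f (at x) v))) (at x)"
      if "x \<in> S" for x
      by (rule bounded_linear.has_derivative[OF assms(1) ck_on_Suc_has_derivative[OF Suc.prems that]])
  qed (use Suc in auto)
qed

lemma ck_on_add:
  assumes "open S" "ck_on k S f" "ck_on k S g"
  shows "ck_on k S (\<lambda>x. f x + g x)"
  using assms(2,3)
proof (induction k arbitrary: f g)
  case 0
  then show ?case by (auto intro: continuous_on_add)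
next
  case (Suc k)
  show ?case
  proof (rule ck_on_SucI[OF assms(1)])
    show "((\<lambda>x. f x + g x) has_derivative
        (\<lambda>v. frechet_derivative f (at x) v + frechet_derivative g (at x) v)) (at x)"
      if "x \<in> S" for x
      by (intro has_derivative_add ck_on_Suc_has_derivative[OF Suc.prems(1) that]
          ck_on_Suc_has_derivative[OF Suc.prems(2) that])
  qed (use Suc in auto)
qed

lemma ck_on_sum:
  assumes "open S" "finite I" "\<And>i. i \<in> I \<Longrightarrow> ck_on k S (f i)"
  shows "ck_on k S (\<lambda>x. \<Sum>i\<in>I. f i x)"
  using assms(2,3)
proof (induction I rule: finite_induct)
  case empty
  then show ?case by (simp add: ck_on_const)
next
  case (insert i I)
  then show ?case by (simp add: ck_on_add[OF assms(1)])
qed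

lemma ck_on_bilinear:
  assumes "bounded_bilinear B" "open S" "ck_on k S f" "ck_on k S g"
  shows "ck_on k S (\<lambda>x. B (f x) (g x))"
  using assms(3,4)
proof (induction k arbitrary: f g)
  case 0
  then show ?case using assms(1) by (auto intro: bounded_bilinear.continuous_on)
next
  case (Suc k)
  show ?case
  proof (rule ck_on_SucI[OF assms(2)])
    show "((\<lambda>x. B (f x) (g x)) has_derivative
        (\<lambda>v. B (f x) (frechet_derivative g (at x) v) + B (frechet_derivative f (at x) v) (g x))) (at x)"
      if "x \<in> S" for x
      by (intro bounded_bilinear.FDERIV[OF assms(1)] ck_on_Suc_has_derivative[OF Suc.prems(1) that]
          ck_on_Suc_has_derivative[OF Suc.prems(2) that])
    show "ck_on k S (\<lambda>x. B (f x) (frechet_derivative g (at x) v)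
        + B (frechet_derivative f (at x) v) (g x))" for v
      using Suc.prems ck_on_SucD[OF Suc.prems(1)] ck_on_SucD[OF Suc.prems(2)]
      by (intro ck_on_add assms(2) Suc.IH) auto
  qed
qed

text \<open>In the chain rule the derivative of \<open>f\<close> is taken in a direction that varies
  with the point, while \<open>ck_on\<close> speaks of fixed directions. Expanding that direction in
  \<open>Basis\<close> turns the derivative into a finite sum of products of functions of class
  \<open>k\<close>; hence the Euclidean spaces.\<close>

lemma ck_on_compose:
  fixes g :: "'a::euclidean_space \<Rightarrow> 'b::euclidean_space"
  assumes "open S" "open T" "g ` S \<subseteq> T" "ck_on k S g" "ck_on k T f"
  shows "ck_on k S (\<lambda>x. f (g x))"
  using assms(4,5)
proof (induction k arbitrary: f)
  case 0
  then show ?case using assms(3) by (auto intro: continuous_on_compose2)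
next
  case (Suc k)
  show ?case
  proof (rule ck_on_SucI[OF assms(1)])
    fix x assume x: "x \<in> S"
    let ?f' = "frechet_derivative f (at (g x))" and ?g' = "frechet_derivative g (at x)"
    have f': "(f has_derivative ?f') (at (g x))"
      using ck_on_Suc_has_derivative[OF Suc.prems(2)] x assms(3) by blast
    have "((\<lambda>x. f (g x)) has_derivative (\<lambda>v. ?f' (?g' v))) (at x)"
      using has_derivative_compose[OF ck_on_Suc_has_derivative[OF Suc.prems(1) x] f'] .
    moreover have "(\<lambda>v. ?f' (?g' v)) = (\<lambda>v. \<Sum>b\<in>Basis. (?g' v \<bullet> b) *\<^sub>R ?f' b)"
    proof
      fix v let ?w = "?g' v"
      have "?f' (\<Sum>b\<in>Basis. (?w \<bullet> b) *\<^sub>R b) = (\<Sum>b\<in>Basis. (?w \<bullet> b) *\<^sub>R ?f' b)"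
        using has_derivative_linear[OF f'] by (simp add: linear_sum linear_cmul)
      then show "?f' ?w = (\<Sum>b\<in>Basis. (?w \<bullet> b) *\<^sub>R ?f' b)"
        by (simp only: euclidean_representation)
    qed
    ultimately show "((\<lambda>x. f (g x)) has_derivative
        (\<lambda>v. \<Sum>b\<in>Basis. (?g' v \<bullet> b) *\<^sub>R ?f' b)) (at x)"
      by (simp only:)
  next
    fix v
    show "ck_on k S (\<lambda>x. \<Sum>b\<in>Basis. (frechet_derivative g (at x) v \<bullet> b) *\<^sub>R
        frechet_derivative f (at (g x)) b)"
    proof (intro ck_on_sum assms(1) finite_Basis ck_on_bilinear[OF bounded_bilinear_scaleR])
      fix b :: 'b
      show "ck_on k S (\<lambda>x. frechet_derivative g (at x) v \<bullet> b)"
        using Suc.prems(1) by (intro ck_on_linear[OF bounded_linear_inner_left assms(1)]) auto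
      show "ck_on k S (\<lambda>x. frechet_derivative f (at (g x)) b)"
        using Suc.prems by (intro Suc.IH[OF ck_on_SucD]) auto
    qed
  qed
qed

subsection \<open>Bump functions\<close>

text \<open>The case \<open>n = 0\<close> is the classical smooth function that is flat at 0. The
  powers of 1/t are carried along because derivatives of members of this family are linear
  combinations of members, so smoothness is an induction over the order for all \<open>n\<close> at
  once.\<close>

definition flat :: "nat \<Rightarrow> real \<Rightarrow> real" where
  "flat n t = (if t > 0 then (1 / t) ^ n * exp (- (1 / t)) else 0)"

lemma flat_has_derivative:
  "(flat n has_real_derivative (- real n * flat (Suc n) t + flat (Suc (Suc n)) t)) (at t)"
proof -
  consider "t > 0" | "t < 0" | "t = 0" by linarith
  then show ?thesis
  proof cases
    case 1
    have "((\<lambda>t. (1 / t) ^ n * exp (- (1 / t))) has_real_derivative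
        (- real n * flat (Suc n) t + flat (Suc (Suc n)) t)) (at t)"
    proof -
      have "((\<lambda>t. (1 / t) ^ n * exp (- (1 / t))) has_real_derivative
          real n * (1 / t) ^ (n - 1) * (- (1 / t ^ 2)) * exp (- (1 / t))
          + (1 / t) ^ n * (exp (- (1 / t)) * (1 / t ^ 2))) (at t)"
        using 1 by (auto simp: power2_eq_square intro!: derivative_eq_intros)
      moreover have "real n * (1 / t) ^ (n - 1) * (- (1 / t ^ 2)) * exp (- (1 / t))
          + (1 / t) ^ n * (exp (- (1 / t)) * (1 / t ^ 2))
          = - real n * flat (Suc n) t + flat (Suc (Suc n)) t"
        using 1 by (cases n) (auto simp: flat_def power2_eq_square power_one_over field_simps)
      ultimately show ?thesis by simp
    qed
    then show ?thesis
      by (rule has_field_derivative_transform_within_open[of _ _ _ "{0<..}"])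
        (use 1 in \<open>auto simp: flat_def\<close>)
  next
    case 2
    have "((\<lambda>t. 0) has_real_derivative 0) (at t)" by simp
    then have "(flat n has_real_derivative 0) (at t)"
      by (rule has_field_derivative_transform_within_open[of _ _ _ "{..<0}"])
        (use 2 in \<open>auto simp: flat_def\<close>)
    then show ?thesis using 2 by (simp add: flat_def)
  next
    case 3
    \<comment> \<open>The difference quotient of \<open>flat n\<close> at 0 is
      \<open>flat (Suc n)\<close>, so the derivative there is the limit of that function.\<close>
    have "((\<lambda>h. (1 / h) ^ Suc n * exp (- (1 / h))) \<longlongrightarrow> 0) (at_right (0::real))"
      by real_asymp
    then have "(flat (Suc n) \<longlongrightarrow> 0) (at_right 0)"
      by (rule Lim_transform_eventually)
        (auto simp: flat_def eventually_at_filter)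
    moreover have "(flat (Suc n) \<longlongrightarrow> 0) (at_left 0)"
      by (rule Lim_transform_eventually[of "\<lambda>_. 0"])
        (auto simp: flat_def eventually_at_filter)
    ultimately have "(flat (Suc n) \<longlongrightarrow> 0) (at 0)"
      by (simp add: filterlim_split_at)
    then have "((\<lambda>h. (flat n (0 + h) - flat n 0) / h) \<longlongrightarrow> 0) (at 0)"
      by (rule Lim_transform_eventually) (auto simp: flat_def eventually_at_filter)
    then show ?thesis using 3 by (simp add: DERIV_def flat_def)
  qed
qed

lemma ck_on_flat: "ck_on k UNIV (flat n)"
proof (induction k arbitrary: n)
  case 0
  show ?case using flat_has_derivative
    by (auto intro!: continuous_at_imp_continuous_on DERIV_isCont)
next
  case (Suc k)
  show ?case
  proof (rule ck_on_SucI[OF open_UNIV])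
    show "(flat n has_derivative
        (\<lambda>v. (- real n * flat (Suc n) t + flat (Suc (Suc n)) t) * v)) (at t)" for t
      using flat_has_derivative[of n t] by (simp add: has_field_derivative_def)
    show "ck_on k UNIV (\<lambda>t. (- real n * flat (Suc n) t + flat (Suc (Suc n)) t) * v)" for v
      by (intro ck_on_linear[OF bounded_linear_mult_left] ck_on_add open_UNIV
          ck_on_linear[OF bounded_linear_mult_right] Suc)
  qed
qed

text \<open>The squared distance is used because, unlike the norm, it is smooth at the
  centre.\<close>

lemma ck_on_bump: "ck_on k UNIV (\<lambda>y. flat 0 (r - (y - a) \<bullet> (y - a)))"
  for a :: "'b::euclidean_space"
proof (rule ck_on_compose[OF open_UNIV open_UNIV _ _ ck_on_flat])
  have id: "ck_on k UNIV (\<lambda>y::'b. y)"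
    by (cases k) (auto simp: frechet_derivative_ident ck_on_const)
  have "ck_on k UNIV (\<lambda>y. y - a)"
    using ck_on_add[OF open_UNIV id ck_on_const[where c="-a"]] by simp
  then have "ck_on k UNIV (\<lambda>y. - ((y - a) \<bullet> (y - a)))"
    by (intro ck_on_linear[OF bounded_linear_minus[OF bounded_linear_ident] open_UNIV]
        ck_on_bilinear[OF bounded_bilinear_inner open_UNIV])
  then show "ck_on k UNIV (\<lambda>y. r - (y - a) \<bullet> (y - a))"
    using ck_on_add[OF open_UNIV ck_on_const[where c=r]] by fastforce
qed simp

subsection \<open>The algebra of smooth functions\<close>

lemma smooth_fun_iff:
  "f \<in> smooth_fun M \<longleftrightarrow> (\<forall>(U, \<phi>)\<in>atlas M. \<forall>k. ck_on k (\<phi> ` U) (\<lambda>x. f (inv_into U \<phi> x)))"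
  by (simp add: smooth_fun_def smooth_on_def comp_def)

lemma smooth_atlas_chart:
  assumes "smooth_atlas \<A>" "(U, \<phi>) \<in> \<A>"
  shows "open U" "open (\<phi> ` U)" "homeomorphism U (\<phi> ` U) \<phi> (inv_into U \<phi>)"
proof -
  have "is_chart (U, \<phi>)" using assms unfolding smooth_atlas_def by blast
  then show "open U" "open (\<phi> ` U)" "homeomorphism U (\<phi> ` U) \<phi> (inv_into U \<phi>)"
    by (simp_all add: is_chart_def)
qed

lemma smooth_funD:
  "f \<in> smooth_fun M \<Longrightarrow> (U, \<phi>) \<in> atlas M \<Longrightarrow> ck_on k (\<phi> ` U) (\<lambda>x. f (inv_into U \<phi> x))"
  unfolding smooth_fun_iff by blast

lemma smooth_funI:
  assumes "smooth_atlas (atlas M)"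
    and "\<And>U \<phi> k. (U, \<phi>) \<in> atlas M \<Longrightarrow> open (\<phi> ` U)
      \<Longrightarrow> ck_on k (\<phi> ` U) (\<lambda>x. f (inv_into U \<phi> x))"
  shows "f \<in> smooth_fun M"
  unfolding smooth_fun_iff
proof clarify
  fix U \<phi> k assume "(U, \<phi>) \<in> atlas M"
  then show "ck_on k (\<phi> ` U) (\<lambda>x. f (inv_into U \<phi> x))"
    using assms(2) smooth_atlas_chart(2)[OF assms(1)] by blast
qed

lemma smooth_const: "(\<lambda>p. c) \<in> smooth_fun M"
  unfolding smooth_fun_iff using ck_on_const by blast

lemma smooth_add:
  assumes "smooth_atlas (atlas M)" "f \<in> smooth_fun M" "g \<in> smooth_fun M"
  shows "(\<lambda>p. f p + g p) \<in> smooth_fun M"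
  by (rule smooth_funI[OF assms(1)]) (rule ck_on_add[OF _ smooth_funD[OF assms(2)] smooth_funD[OF assms(3)]], assumption+)

lemma smooth_linear:
  assumes "smooth_atlas (atlas M)" "bounded_linear L" "f \<in> smooth_fun M"
  shows "(\<lambda>p. L (f p)) \<in> smooth_fun M"
  by (rule smooth_funI[OF assms(1)]) (rule ck_on_linear[OF assms(2) _ smooth_funD[OF assms(3)]], assumption+)

lemma smooth_mult:
  fixes f g :: "'a::topological_space \<Rightarrow> 'b::real_normed_algebra"
  assumes "smooth_atlas (atlas M)" "f \<in> smooth_fun M" "g \<in> smooth_fun M"
  shows "(\<lambda>p. f p * g p) \<in> smooth_fun M"
  by (rule smooth_funI[OF assms(1)])
    (rule ck_on_bilinear[OF bounded_bilinear_mult _ smooth_funD[OF assms(2)] smooth_funD[OF assms(3)]], assumption+)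

text \<open>A bump in one chart is extended by zero. It is supported in the preimage
  \<open>K\<close> of a closed ball, which is compact and therefore closed because the space is
  Hausdorff. So \<open>V\<close>, where the chart formula holds, and the complement of
  \<open>K\<close>, where the function is zero, form an open cover, and smoothness is checked in any
  other chart on each of the two.\<close>

lemma exists_bump:
  fixes M :: "'a::t2_space contact_data"
  assumes A: "smooth_atlas (atlas M)" and "open U" "p \<in> U"
  shows "\<exists>\<theta>::'a \<Rightarrow> real. \<theta> \<in> smooth_fun M \<and> \<theta> p \<noteq> 0 \<and> (\<forall>q. q \<notin> U \<longrightarrow> \<theta> q = 0)"
proof -
  have "p \<in> (\<Union>(U, \<phi>)\<in>atlas M. U)" using A by (simp add: smooth_atlas_def)
  then obtain V \<phi> where V: "(V, \<phi>) \<in> atlas M" "p \<in> V" by blast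
  let ?i = "inv_into V \<phi>"
  note hom = smooth_atlas_chart(3)[OF A V(1)] and oV = smooth_atlas_chart(1,2)[OF A V(1)]
  have inj: "?i (\<phi> q) = q" if "q \<in> V" for q using hom that by (simp add: homeomorphism_def)
  have "open (\<phi> ` (V \<inter> U))"
    using homeomorphism_imp_open_map[OF hom, of "V \<inter> U"] oV \<open>open U\<close>
    by (auto simp: openin_open_eq)
  then obtain r where r: "r > 0" "cball (\<phi> p) r \<subseteq> \<phi> ` (V \<inter> U)"
    using V(2) \<open>p \<in> U\<close> unfolding open_contains_cball by blast
  define K where "K = ?i ` cball (\<phi> p) r"
  have K: "K \<subseteq> V \<inter> U"
  proof
    fix x assume "x \<in> K"
    then obtain y where "x = ?i y" "y \<in> \<phi> ` (V \<inter> U)" using r(2) unfolding K_def by blast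
    then obtain q where "x = ?i (\<phi> q)" "q \<in> V" "q \<in> U" by blast
    then show "x \<in> V \<inter> U" by (simp only: inj Int_iff)
  qed
  have "continuous_on (cball (\<phi> p) r) ?i"
    using hom r(2) by (auto simp: homeomorphism_def intro: continuous_on_subset)
  then have "closed K" unfolding K_def
    by (intro compact_imp_closed compact_continuous_image) auto
  define b where "b = (\<lambda>y. flat 0 (r\<^sup>2 - (y - \<phi> p) \<bullet> (y - \<phi> p)))"
  have bk: "ck_on k UNIV b" for k unfolding b_def by (rule ck_on_bump)
  define \<theta> where "\<theta> = (\<lambda>q. if q \<in> V then b (\<phi> q) else 0)"
  have b0: "b y = 0" if "y \<notin> cball (\<phi> p) r" for y
  proof -
    have "r \<le> norm (y - \<phi> p)" using that by (simp add: dist_norm norm_minus_commute)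
    then have "r\<^sup>2 \<le> (norm (y - \<phi> p))\<^sup>2" using r(1) by (intro power_mono) auto
    then show ?thesis by (simp add: b_def flat_def power2_norm_eq_inner)
  qed
  have \<theta>0: "\<theta> q = 0" if "q \<notin> K" for q
  proof (cases "q \<in> V")
    case True
    then have "\<phi> q \<notin> cball (\<phi> p) r" using that inj by (force simp: K_def)
    then show ?thesis by (simp add: \<theta>_def b0)
  qed (simp add: \<theta>_def)
  have "\<theta> \<in> smooth_fun M" unfolding smooth_fun_iff
  proof clarify
    fix W \<psi> k assume W: "(W, \<psi>) \<in> atlas M"
    let ?j = "inv_into W \<psi>"
    note hW = smooth_atlas_chart(3)[OF A W] and oW = smooth_atlas_chart(1,2)[OF A W]
    have j: "?j (\<psi> q) = q" if "q \<in> W" for q using hW that by (simp add: homeomorphism_def)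
    have op: "open (\<psi> ` (W \<inter> T))" if "open T" for T
      using homeomorphism_imp_open_map[OF hW, of "W \<inter> T"] oW that
      by (auto simp: openin_open_eq)
    have "smooth_on (\<psi> ` (W \<inter> V)) (\<phi> \<circ> ?j)"
      using A W V(1) unfolding smooth_atlas_def by fast
    then have "ck_on k (\<psi> ` (W \<inter> V)) (\<lambda>x. \<phi> (?j x))"
      by (simp add: smooth_on_def comp_def)
    then have "ck_on k (\<psi> ` (W \<inter> V)) (\<lambda>x. b (\<phi> (?j x)))"
      using ck_on_compose[where f=b and g="\<lambda>x. \<phi> (?j x)", OF op[OF oV(1)] open_UNIV _ _ bk]
      by simp
    then have 1: "ck_on k (\<psi> ` (W \<inter> V)) (\<lambda>x. \<theta> (?j x))"
      by (rule ck_on_cong[OF op[OF oV(1)], rotated]) (auto simp: \<theta>_def j)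
    have 2: "ck_on k (\<psi> ` (W \<inter> - K)) (\<lambda>x. \<theta> (?j x))"
      using ck_on_const[where c=0]
      by (rule ck_on_cong[OF op, rotated 2]) (use \<open>closed K\<close> in \<open>auto simp: \<theta>0 j\<close>)
    have "\<psi> ` W = \<psi> ` (W \<inter> V) \<union> \<psi> ` (W \<inter> - K)" using K by auto
    then show "ck_on k (\<psi> ` W) (\<lambda>x. \<theta> (?j x))"
      using ck_on_union[OF 1 2 op[OF oV(1)] op] \<open>closed K\<close> by auto
  qed
  moreover have "\<theta> p \<noteq> 0" using V(2) r(1) by (simp add: \<theta>_def b_def flat_def)
  moreover have "\<theta> q = 0" if "q \<notin> U" for q using \<theta>0 K that by blast
  ultimately show ?thesis by blast
qed

subsection \<open>Vector fields\<close>

lemma smooth_diff: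
  "smooth_atlas (atlas M) \<Longrightarrow> f \<in> smooth_fun M \<Longrightarrow> g \<in> smooth_fun M
    \<Longrightarrow> (\<lambda>p. f p - g p) \<in> smooth_fun M"
  using smooth_add[of M f "\<lambda>p. - g p"]
    smooth_linear[OF _ bounded_linear_minus[OF bounded_linear_ident], of M g]
  by simp

lemma vf_smooth: "X \<in> vector_fields M \<Longrightarrow> f \<in> smooth_fun M \<Longrightarrow> X f \<in> smooth_fun M"
  by (simp add: vector_fields_def)

lemma vf_lincomb:
  "X \<in> vector_fields M \<Longrightarrow> f \<in> smooth_fun M \<Longrightarrow> g \<in> smooth_fun M
    \<Longrightarrow> X (\<lambda>q. a * f q + b * g q) p = a * X f p + b * X g p"
  by (simp add: vector_fields_def)

lemma vf_mult:
  "X \<in> vector_fields M \<Longrightarrow> f \<in> smooth_fun M \<Longrightarrow> g \<in> smooth_fun M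
    \<Longrightarrow> X (\<lambda>q. f q * g q) p = X f p * g p + f p * X g p"
  by (simp add: vector_fields_def)

lemma vf_add:
  "X \<in> vector_fields M \<Longrightarrow> f \<in> smooth_fun M \<Longrightarrow> g \<in> smooth_fun M
    \<Longrightarrow> X (\<lambda>q. f q + g q) p = X f p + X g p"
  using vf_lincomb[of X M f g 1 1] by simp

lemma vf_diff:
  "X \<in> vector_fields M \<Longrightarrow> f \<in> smooth_fun M \<Longrightarrow> g \<in> smooth_fun M
    \<Longrightarrow> X (\<lambda>q. f q - g q) p = X f p - X g p"
  using vf_lincomb[of X M f g 1 "-1"] by simp

lemma vf_const:
  assumes "X \<in> vector_fields M"
  shows "X (\<lambda>q. c) p = 0"
proof -
  have 1: "X (\<lambda>q. 1) p = 0"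
    using vf_mult[OF assms smooth_const smooth_const, of 1 1] by simp
  show ?thesis
    using vf_lincomb[OF assms smooth_const[of 1] smooth_const[of 1], of c 0] 1 by simp
qed

lemma vf_nonsmooth: "X \<in> vector_fields M \<Longrightarrow> f \<notin> smooth_fun M \<Longrightarrow> X f = (\<lambda>p. 0)"
  by (simp add: vector_fields_def)

lemma vf_uminus:
  "X \<in> vector_fields M \<Longrightarrow> f \<in> smooth_fun M \<Longrightarrow> X (\<lambda>q. - f q) p = - X f p"
  using vf_lincomb[of X M f f "-1" 0] by simp

lemma vector_fieldsI:
  assumes "\<And>f. f \<in> smooth_fun M \<Longrightarrow> X f \<in> smooth_fun M"
    and "\<And>f p. f \<notin> smooth_fun M \<Longrightarrow> X f p = 0"
    and "\<And>f g a b p. f \<in> smooth_fun M \<Longrightarrow> g \<in> smooth_fun M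
      \<Longrightarrow> X (\<lambda>q. a * f q + b * g q) p = a * X f p + b * X g p"
    and "\<And>f g p. f \<in> smooth_fun M \<Longrightarrow> g \<in> smooth_fun M
      \<Longrightarrow> X (\<lambda>q. f q * g q) p = X f p * g p + f p * X g p"
  shows "X \<in> vector_fields M"
  unfolding vector_fields_def using assms by (simp add: fun_eq_iff)

locale smooth_data =
  fixes M :: "'a::{t2_space,second_countable_topology} contact_data"
  assumes atlas: "smooth_atlas (atlas M)"
begin

lemmas smooth_ring = smooth_const smooth_add[OF atlas] smooth_diff[OF atlas] smooth_mult[OF atlas]

lemma vzero_vf: "vzero \<in> vector_fields M"
  by (rule vector_fieldsI) (simp_all add: vzero_def smooth_const)

lemma vadd_vf:
  assumes X: "X \<in> vector_fields M" and Y: "Y \<in> vector_fields M"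
  shows "vadd X Y \<in> vector_fields M"
proof (rule vector_fieldsI)
  show "vadd X Y f \<in> smooth_fun M" if "f \<in> smooth_fun M" for f
    unfolding vadd_def by (intro smooth_ring vf_smooth[OF X] vf_smooth[OF Y] that)
qed (simp_all add: vadd_def vf_nonsmooth[OF X] vf_nonsmooth[OF Y] vf_lincomb[OF X] vf_lincomb[OF Y]
    vf_mult[OF X] vf_mult[OF Y] algebra_simps)

lemma vmult_vf:
  assumes h: "h \<in> smooth_fun M" and X: "X \<in> vector_fields M"
  shows "vmult h X \<in> vector_fields M"
proof (rule vector_fieldsI)
  show "vmult h X f \<in> smooth_fun M" if "f \<in> smooth_fun M" for f
    unfolding vmult_def by (intro smooth_ring vf_smooth[OF X] h that)
qed (simp_all add: vmult_def vf_nonsmooth[OF X] vf_lincomb[OF X] vf_mult[OF X] algebra_simps)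

lemma vsub_eq: "vsub X Y = vadd X (vmult (\<lambda>p. - 1) Y)"
  for Y :: "'f \<Rightarrow> 'b \<Rightarrow> 'c::ring_1"
  by (simp add: vsub_def vadd_def vmult_def)

lemma vsub_vf:
  "X \<in> vector_fields M \<Longrightarrow> Y \<in> vector_fields M \<Longrightarrow> vsub X Y \<in> vector_fields M"
  by (simp add: vsub_eq vadd_vf vmult_vf smooth_const)

lemma bracket_vf:
  assumes X: "X \<in> vector_fields M" and Y: "Y \<in> vector_fields M"
  shows "bracket X Y \<in> vector_fields M"
proof (rule vector_fieldsI)
  show "bracket X Y f \<in> smooth_fun M" if "f \<in> smooth_fun M" for f
    unfolding bracket_def by (intro smooth_ring vf_smooth[OF X] vf_smooth[OF Y] that)
  show "bracket X Y f p = 0" if "f \<notin> smooth_fun M" for f p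
    by (simp add: bracket_def vf_nonsmooth[OF X that] vf_nonsmooth[OF Y that] vf_const[OF X]
        vf_const[OF Y])
  fix f g :: "'a \<Rightarrow> real" and p assume fg: "f \<in> smooth_fun M" "g \<in> smooth_fun M"
  have lin: "Z (\<lambda>q. a * f q + b * g q) = (\<lambda>q. a * Z f q + b * Z g q)"
    if "Z \<in> vector_fields M" for Z a b
    by (rule ext) (rule vf_lincomb[OF that fg])
  have mul: "Z (\<lambda>q. f q * g q) = (\<lambda>q. Z f q * g q + f q * Z g q)"
    if "Z \<in> vector_fields M" for Z
    by (rule ext) (rule vf_mult[OF that fg])
  note sm = vf_smooth[OF X fg(1)] vf_smooth[OF X fg(2)] vf_smooth[OF Y fg(1)] vf_smooth[OF Y fg(2)]
  show "bracket X Y (\<lambda>q. a * f q + b * g q) p = a * bracket X Y f p + b * bracket X Y g p" for a b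
    by (simp add: bracket_def lin[OF X] lin[OF Y] vf_lincomb[OF X] vf_lincomb[OF Y] sm algebra_simps)
  show "bracket X Y (\<lambda>q. f q * g q) p = bracket X Y f p * g p + f p * bracket X Y g p"
    by (simp add: bracket_def mul[OF X] mul[OF Y] vf_add[OF X] vf_add[OF Y] vf_mult[OF X]
        vf_mult[OF Y] smooth_ring sm fg algebra_simps)
qed

lemmas vf_closed = vzero_vf vadd_vf vmult_vf vsub_vf bracket_vf

text \<open>Equality of fields is equality on all functions, hence a separate case for non-smooth
  \<open>f\<close>: fields send these to zero and then kill the resulting constant.\<close>

lemma bracket_vmult_left:
  assumes X: "X \<in> vector_fields M" and Y: "Y \<in> vector_fields M" and h: "h \<in> smooth_fun M"
  shows "bracket (vmult h X) Y = vsub (vmult h (bracket X Y)) (vmult (Y h) X)"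
proof (intro ext)
  fix f p
  show "bracket (vmult h X) Y f p = vsub (vmult h (bracket X Y)) (vmult (Y h) X) f p"
  proof (cases "f \<in> smooth_fun M")
    case True
    then show ?thesis
      using vf_mult[OF Y h vf_smooth[OF X True]]
      by (simp add: bracket_def vmult_def vsub_def algebra_simps)
  next
    case False
    then show ?thesis
      by (simp add: bracket_def vmult_def vsub_def vf_nonsmooth[OF X] vf_nonsmooth[OF Y]
          vf_const[OF X] vf_const[OF Y])
  qed
qed

lemma bracket_vadd_left:
  assumes X: "X \<in> vector_fields M" and X': "X' \<in> vector_fields M" and Y: "Y \<in> vector_fields M"
  shows "bracket (vadd X X') Y = vadd (bracket X Y) (bracket X' Y)"
proof (intro ext)
  fix f p
  show "bracket (vadd X X') Y f p = vadd (bracket X Y) (bracket X' Y) f p"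
  proof (cases "f \<in> smooth_fun M")
    case True
    then show ?thesis
      using vf_add[OF Y vf_smooth[OF X True] vf_smooth[OF X' True]]
      by (simp add: bracket_def vadd_def algebra_simps)
  next
    case False
    then show ?thesis
      by (simp add: bracket_def vadd_def vf_nonsmooth[OF X] vf_nonsmooth[OF X'] vf_nonsmooth[OF Y]
          vf_const[OF X] vf_const[OF X'] vf_const[OF Y])
  qed
qed

lemma bracket_swap: "bracket X Y = vmult (\<lambda>p. - 1) (bracket Y X)"
  by (simp add: bracket_def vmult_def)

lemma jacobi:
  assumes X: "X \<in> vector_fields M" and Y: "Y \<in> vector_fields M" and Z: "Z \<in> vector_fields M"
  shows "bracket X (bracket Y Z) f p + bracket Y (bracket Z X) f p + bracket Z (bracket X Y) f p = 0"
proof (cases "f \<in> smooth_fun M")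
  case True
  have *: "V (\<lambda>q. W (W' f) q - W' (W f) q) p = V (W (W' f)) p - V (W' (W f)) p"
    if "V \<in> vector_fields M" "W \<in> vector_fields M" "W' \<in> vector_fields M" for V W W'
    by (rule vf_diff[OF that(1) vf_smooth[OF that(2) vf_smooth[OF that(3) True]]
          vf_smooth[OF that(3) vf_smooth[OF that(2) True]]])
  show ?thesis using *[OF X Y Z] *[OF Y Z X] *[OF Z X Y] by (simp add: bracket_def)
next
  case False
  then show ?thesis
    by (simp add: vf_nonsmooth[OF bracket_vf[OF X bracket_vf[OF Y Z]]]
        vf_nonsmooth[OF bracket_vf[OF Y bracket_vf[OF Z X]]]
        vf_nonsmooth[OF bracket_vf[OF Z bracket_vf[OF X Y]]])
qed

end

lemma sum_1_4: "(\<Sum>i=1..4. f i) = f 1 + f 2 + f 3 + f (4::nat)"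
proof -
  have "{1..4::nat} = {1,2,3,4}" by auto
  then show ?thesis by (simp add: add.assoc)
qed

subsection \<open>Contact metric manifolds\<close>

locale contact_metric =
  fixes M :: "'a::{t2_space,second_countable_topology} contact_data"
  assumes cmm: "contact_metric_manifold M"
begin

sublocale smooth_data
  using cmm by unfold_locales (simp add: contact_metric_manifold_def)

abbreviation "VF \<equiv> vector_fields M"
abbreviation "HF \<equiv> horizontal_fields M"
abbreviation "SF \<equiv> smooth_fun M"
abbreviation "J \<equiv> cstr M"
abbreviation "g \<equiv> metric M"

lemma HF_iff: "X \<in> HF \<longleftrightarrow> X \<in> VF \<and> (\<forall>p. eta M X p = 0)"
  by (simp add: horizontal_fields_def)

lemma HF_vf: "X \<in> HF \<Longrightarrow> X \<in> VF" and eta_HF: "X \<in> HF \<Longrightarrow> eta M X p = 0"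
  by (simp_all add: HF_iff)

lemma reeb_vf: "reeb M \<in> VF" and eta_reeb: "eta M (reeb M) p = 1"
  and deta_reeb: "X \<in> VF \<Longrightarrow> deta M (reeb M) X p = 0"
  using cmm by (simp_all add: contact_metric_manifold_def)

lemma eta_form: "is_one_form M (eta M)"
  using cmm by (simp add: contact_metric_manifold_def is_contact_form_def)

lemma eta_smooth: "X \<in> VF \<Longrightarrow> eta M X \<in> SF"
  and eta_vadd: "X \<in> VF \<Longrightarrow> Y \<in> VF \<Longrightarrow> eta M (vadd X Y) p = eta M X p + eta M Y p"
  and eta_vmult: "X \<in> VF \<Longrightarrow> h \<in> SF \<Longrightarrow> eta M (vmult h X) p = h p * eta M X p"
  using eta_form by (simp_all add: is_one_form_def)

lemma eta_vsub: "X \<in> VF \<Longrightarrow> Y \<in> VF \<Longrightarrow> eta M (vsub X Y) p = eta M X p - eta M Y p"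
  by (simp add: vsub_eq eta_vadd eta_vmult vmult_vf smooth_const)

lemma eta_vzero: "eta M vzero p = 0"
  using eta_vsub[OF vzero_vf vzero_vf] by (simp add: vsub_def vzero_def)

lemma g_form: "X \<in> VF \<Longrightarrow> is_one_form M (g X)"
  and g_sym: "X \<in> VF \<Longrightarrow> Y \<in> VF \<Longrightarrow> g X Y p = g Y X p"
  and g_nonneg: "X \<in> VF \<Longrightarrow> 0 \<le> g X X p"
  and g_zero_iff: "X \<in> VF \<Longrightarrow> g X X p = 0 \<longleftrightarrow> (\<forall>f. X f p = 0)"
  using cmm by (simp_all add: contact_metric_manifold_def is_riemannian_def)

lemma g_smooth: "X \<in> VF \<Longrightarrow> Y \<in> VF \<Longrightarrow> g X Y \<in> SF"
  and g_vadd: "X \<in> VF \<Longrightarrow> Y \<in> VF \<Longrightarrow> Z \<in> VF \<Longrightarrow> g X (vadd Y Z) p = g X Y p + g X Z p"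
  and g_vmult: "X \<in> VF \<Longrightarrow> Y \<in> VF \<Longrightarrow> h \<in> SF \<Longrightarrow> g X (vmult h Y) p = h p * g X Y p"
  using g_form[of X] by (simp_all add: is_one_form_def)

lemma g_vsub: "X \<in> VF \<Longrightarrow> Y \<in> VF \<Longrightarrow> Z \<in> VF \<Longrightarrow> g X (vsub Y Z) p = g X Y p - g X Z p"
  by (simp add: vsub_eq g_vadd g_vmult vmult_vf smooth_const)

lemma g_vadd_left: "X \<in> VF \<Longrightarrow> Y \<in> VF \<Longrightarrow> Z \<in> VF \<Longrightarrow> g (vadd Y Z) X p = g Y X p + g Z X p"
  and g_vsub_left: "X \<in> VF \<Longrightarrow> Y \<in> VF \<Longrightarrow> Z \<in> VF \<Longrightarrow> g (vsub Y Z) X p = g Y X p - g Z X p"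
  and g_vmult_left: "X \<in> VF \<Longrightarrow> Y \<in> VF \<Longrightarrow> h \<in> SF \<Longrightarrow> g (vmult h Y) X p = h p * g Y X p"
  by (simp_all add: g_sym[of _ X] g_vadd g_vsub g_vmult vadd_vf vsub_vf vmult_vf)

lemma g_vzero: "X \<in> VF \<Longrightarrow> g X vzero p = 0" "X \<in> VF \<Longrightarrow> g vzero X p = 0"
  using g_vmult[OF _ vzero_vf smooth_const[of 0]] g_sym[OF vzero_vf]
  by (auto simp: vmult_def vzero_def)

lemmas g_simps = g_vadd g_vsub g_vmult g_vadd_left g_vsub_left g_vmult_left g_vzero

lemma J_vf: "X \<in> VF \<Longrightarrow> J X \<in> VF"
  and J_vadd: "X \<in> VF \<Longrightarrow> Y \<in> VF \<Longrightarrow> J (vadd X Y) = vadd (J X) (J Y)"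
  and J_vmult: "X \<in> VF \<Longrightarrow> h \<in> SF \<Longrightarrow> J (vmult h X) = vmult h (J X)"
  using cmm by (simp_all add: contact_metric_manifold_def is_endomorphism_def)

lemma J_vsub: "X \<in> VF \<Longrightarrow> Y \<in> VF \<Longrightarrow> J (vsub X Y) = vsub (J X) (J Y)"
  by (simp add: vsub_eq J_vadd J_vmult vmult_vf smooth_const)

lemma J_vzero: "J vzero = vzero"
proof -
  have "(vzero :: 'a vf) = vmult (\<lambda>p. 0) vzero" by (simp add: vmult_def vzero_def)
  then show ?thesis using J_vmult[OF vzero_vf smooth_const[of 0]]
    by (simp add: vmult_def vzero_def)
qed

lemma J_HF: "X \<in> HF \<Longrightarrow> J X \<in> HF" and J_J: "X \<in> HF \<Longrightarrow> J (J X) = vsub vzero X"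
  and deta_J: "X \<in> HF \<Longrightarrow> Y \<in> HF \<Longrightarrow> deta M (J X) (J Y) p = deta M X Y p"
  using cmm by (simp_all add: contact_metric_manifold_def)

lemma HF_closed:
  "vzero \<in> HF" "X \<in> HF \<Longrightarrow> Y \<in> HF \<Longrightarrow> vadd X Y \<in> HF"
  "X \<in> HF \<Longrightarrow> Y \<in> HF \<Longrightarrow> vsub X Y \<in> HF"
  "h \<in> SF \<Longrightarrow> X \<in> HF \<Longrightarrow> vmult h X \<in> HF"
  by (auto simp: HF_iff eta_vzero eta_vadd eta_vsub eta_vmult vf_closed)

lemma g_deta: "X \<in> HF \<Longrightarrow> g X Y p = deta M X (J Y) p"
  by (simp add: metric_def eta_HF)

lemma deta_g: "X \<in> HF \<Longrightarrow> Y \<in> HF \<Longrightarrow> deta M X Y p = g (J X) Y p"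
  by (simp add: g_deta J_HF deta_J)

lemma g_J: "X \<in> HF \<Longrightarrow> Y \<in> HF \<Longrightarrow> g (J X) (J Y) p = g X Y p"
  by (simp add: g_deta J_HF deta_J)

lemma g_J_left:
  assumes X: "X \<in> HF" and Y: "Y \<in> HF"
  shows "g (J X) Y p = - g X (J Y) p"
proof -
  have "g (J X) Y p = g (J (J X)) (J Y) p" using g_J[OF J_HF[OF X] Y] by simp
  also have "\<dots> = - g X (J Y) p"
    using X Y by (simp add: J_J g_simps HF_vf J_HF vzero_vf)
  finally show ?thesis .
qed

lemma g_reeb: "X \<in> HF \<Longrightarrow> g (reeb M) X p = 0" "X \<in> VF \<Longrightarrow> g X (reeb M) p = eta M X p"
  "X \<in> VF \<Longrightarrow> g (reeb M) X p = eta M X p"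
proof -
  show "g (reeb M) X p = eta M X p" if "X \<in> VF" for X
    using that by (simp add: metric_def eta_reeb deta_reeb J_vf)
  then show "X \<in> HF \<Longrightarrow> g (reeb M) X p = 0" "X \<in> VF \<Longrightarrow> g X (reeb M) p = eta M X p"
    by (simp_all add: HF_vf eta_HF g_sym[OF _ reeb_vf])
qed

lemma deta_skew: "deta M X Y p = - deta M Y X p" if "X \<in> HF" "Y \<in> HF"
  using that by (simp add: deta_g g_J_left g_sym[of X] HF_vf J_HF)

lemma hproj_HF: "X \<in> VF \<Longrightarrow> hproj M X \<in> HF"
  by (simp add: hproj_def HF_iff vf_closed reeb_vf eta_smooth eta_vsub eta_vmult eta_reeb)

lemma hproj_id: "X \<in> HF \<Longrightarrow> hproj M X = X"
  by (simp add: hproj_def vsub_def vmult_def eta_HF)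

lemma hproj_decomp: "X = vadd (hproj M X) (vmult (eta M X) (reeb M))"
  by (simp add: hproj_def vadd_def vsub_def vmult_def)

lemma g_hproj: "X \<in> VF \<Longrightarrow> Y \<in> HF \<Longrightarrow> g (hproj M X) Y p = g X Y p"
  by (simp add: hproj_def g_simps reeb_vf HF_vf vf_closed eta_smooth g_reeb)

text \<open>The metric is given on global fields. This degenerate case of Cauchy-Schwarz is what
  makes its value at p depend only on the tangent vectors at p, as stated in
  \<open>g_cong\<close>.\<close>

lemma g_null:
  assumes X: "X \<in> VF" and Y: "Y \<in> VF" and 0: "\<And>f. X f p = 0"
  shows "g X Y p = 0"
proof (rule ccontr)
  assume n: "g X Y p \<noteq> 0"
  have z: "g X X p = 0" using g_zero_iff[OF X] 0 by simp
  \<comment> \<open>As \<open>g X X p = 0\<close>, the square of \<open>Y - t X\<close> at p is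
    affine in t; this t gives it the value - 1.\<close>
  define t where "t = (g Y Y p + 1) / (2 * g X Y p)"
  have "0 \<le> g (vsub Y (vmult (\<lambda>_. t) X)) (vsub Y (vmult (\<lambda>_. t) X)) p"
    by (intro g_nonneg vf_closed X Y smooth_const)
  also have "\<dots> = g Y Y p - 2 * t * g X Y p"
    using X Y by (simp add: g_simps vf_closed smooth_const z g_sym[of Y X])
  also have "\<dots> = - 1" using n by (simp add: t_def field_simps)
  finally show False by simp
qed

lemma g_cong:
  assumes "X \<in> VF" "X' \<in> VF" "Y \<in> VF" "\<And>f. X f p = X' f p"
  shows "g X Y p = g X' Y p"
  using g_null[of "vsub X X'" Y p] assms by (simp add: vsub_vf g_simps) (simp add: vsub_def)

end

section \<open>Pointwise expansion in an adapted frame\<close>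

locale contact_frame = contact_metric +
  fixes U E
  assumes frame: "adapted_frame M U E"
begin

lemma E_HF: "i \<in> {1..4} \<Longrightarrow> E i \<in> HF"
  and E_orth: "q \<in> U \<Longrightarrow> i \<in> {1..4} \<Longrightarrow> j \<in> {1..4} \<Longrightarrow> g (E i) (E j) q = (if i = j then 1 else 0)"
  and E_span: "q \<in> U \<Longrightarrow> X \<in> HF \<Longrightarrow> \<exists>c. \<forall>f. X f q = (\<Sum>i=1..4. c i * E i f q)"
  and E_2: "E 2 = J (E 1)" and E_4: "E 4 = J (E 3)" and E_0: "E 0 = reeb M" and U_open: "open U"
  using frame by (simp_all add: adapted_frame_def)

text \<open>The clause for \<open>E (Suc 0)\<close> is the form into which \<open>simp\<close>
  rewrites \<open>E 1\<close>.\<close>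

lemma E_HFs: "E 1 \<in> HF" "E (Suc 0) \<in> HF" "E 2 \<in> HF" "E 3 \<in> HF" "E 4 \<in> HF"
  using E_HF[of 1] E_HF[of 2] E_HF[of 3] E_HF[of 4] by simp_all

lemma JE: "J (E 1) = E 2" "J (E 2) = vsub vzero (E 1)" "J (E 3) = E 4" "J (E 4) = vsub vzero (E 3)"
  using J_J[OF E_HFs(1)] J_J[OF E_HFs(4)] by (simp_all add: E_2 E_4)

text \<open>The orthonormal expansion, formed as a global field so that tensors can act on it; it is
  compared with \<open>X\<close> only over \<open>U\<close>.\<close>

definition trunc :: "'a vf \<Rightarrow> 'a vf" where
  "trunc X = vadd (vadd (vmult (g X (E 1)) (E 1)) (vmult (g X (E 2)) (E 2)))
     (vadd (vmult (g X (E 3)) (E 3)) (vmult (g X (E 4)) (E 4)))"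

lemma trunc_HF: "X \<in> HF \<Longrightarrow> trunc X \<in> HF"
  unfolding trunc_def by (intro HF_closed g_smooth HF_vf E_HFs)

lemma frame_coords:
  assumes q: "q \<in> U" and X: "X \<in> HF"
  shows "X f q = trunc X f q"
proof -
  obtain c where c: "\<And>f. X f q = (\<Sum>i=1..4. c i * E i f q)" using E_span[OF q X] by blast
  \<comment> \<open>Freezing the coefficients at q as constants gives a global field with the same
    value at q as \<open>X\<close>; \<open>g_cong\<close> then identifies each \<open>c i\<close> as
    an inner product.\<close>
  define Y where "Y = vadd (vadd (vmult (\<lambda>_. c 1) (E 1)) (vmult (\<lambda>_. c 2) (E 2)))
     (vadd (vmult (\<lambda>_. c 3) (E 3)) (vmult (\<lambda>_. c 4) (E 4)))"
  have Y: "Y \<in> VF" unfolding Y_def by (intro vf_closed smooth_const HF_vf E_HFs)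
  have e: "X f q = Y f q" for f
    unfolding c sum_1_4 by (simp add: Y_def vadd_def vmult_def)
  have "g X (E i) q = g Y (E i) q" if "i \<in> {1..4}" for i
    by (rule g_cong[OF HF_vf[OF X] Y HF_vf[OF E_HF[OF that]] e])
  moreover have "g Y (E i) q = c i" if "i \<in> {1..4}" for i
  proof -
    have "i \<in> {1,2,3,4}" using that by auto
    then show ?thesis
      using q by (auto simp: Y_def g_simps vf_closed smooth_const HF_vf E_HF E_HFs E_orth)
  qed
  ultimately have "g X (E i) q = c i" if "i \<in> {1..4}" for i using that by simp
  then show ?thesis unfolding c sum_1_4 by (simp add: trunc_def vadd_def vmult_def)
qed

text \<open>A bump function times \<open>X - trunc X\<close> vanishes identically, so a tensorial map does not see
  the difference at p.\<close>

lemma tensor_expand: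
  fixes L :: "'a vf \<Rightarrow> 'b::real_normed_vector"
  assumes p: "p \<in> U" and X: "X \<in> HF"
    and add: "\<And>Y Z. Y \<in> HF \<Longrightarrow> Z \<in> HF \<Longrightarrow> L (vadd Y Z) = L Y + L Z"
    and mult: "\<And>h Y. h \<in> SF \<Longrightarrow> Y \<in> HF \<Longrightarrow> L (vmult h Y) = h p *\<^sub>R L Y"
  shows "L X = (\<Sum>i=1..4. g X (E i) p *\<^sub>R L (E i))"
proof -
  obtain \<theta> :: "'a \<Rightarrow> real" where \<theta>: "\<theta> \<in> SF" "\<theta> p \<noteq> 0" "\<And>q. q \<notin> U \<Longrightarrow> \<theta> q = 0"
    using exists_bump[OF atlas U_open p] by blast
  have v0: "(vzero :: 'a vf) = vmult (\<lambda>p. 0) vzero" by (simp add: vzero_def vmult_def)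
  have L0: "L vzero = 0"
    by (subst v0, subst mult) (simp_all add: HF_closed smooth_const)
  have D: "vsub X (trunc X) \<in> HF" by (intro HF_closed trunc_HF X)
  have "vmult \<theta> (vsub X (trunc X)) f q = 0" for f q
    by (cases "q \<in> U") (simp_all add: vmult_def vsub_def frame_coords[OF _ X] \<theta>(3))
  then have "vmult \<theta> (vsub X (trunc X)) = vzero" by (simp add: vzero_def fun_eq_iff)
  then have "\<theta> p *\<^sub>R L (vsub X (trunc X)) = 0" using mult[OF \<theta>(1) D] L0 by simp
  then have "L (vsub X (trunc X)) = 0" using \<theta>(2) by simp
  moreover have "X = vadd (trunc X) (vsub X (trunc X))" by (simp add: vadd_def vsub_def)
  ultimately have "L X = L (trunc X)" using add[OF trunc_HF[OF X] D] by simp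
  also have "\<dots> = (\<Sum>i=1..4. g X (E i) p *\<^sub>R L (E i))"
    unfolding trunc_def sum_1_4
    using X by (simp add: add mult HF_closed g_smooth HF_vf E_HFs)
  finally show ?thesis .
qed

end

subsection \<open>Curvature and torsion of the Tanaka-Webster connection\<close>

locale tanaka_webster_manifold = contact_metric +
  fixes nabla
  assumes tw: "tanaka_webster M nabla"
begin

abbreviation "R \<equiv> curv nabla"

text \<open>The Webster (pseudohermitian) torsion, the only part of the torsion that enters the
  Bianchi identity tested against horizontal fields.\<close>

definition tau :: "'a vf \<Rightarrow> 'a vf" where "tau Y = torsion nabla (reeb M) Y"

lemma nabla_vf: "X \<in> VF \<Longrightarrow> Y \<in> VF \<Longrightarrow> nabla X Y \<in> VF"
  and nabla_vadd_left: "X \<in> VF \<Longrightarrow> X' \<in> VF \<Longrightarrow> Y \<in> VF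
    \<Longrightarrow> nabla (vadd X X') Y = vadd (nabla X Y) (nabla X' Y)"
  and nabla_vmult_left: "X \<in> VF \<Longrightarrow> Y \<in> VF \<Longrightarrow> h \<in> SF
    \<Longrightarrow> nabla (vmult h X) Y = vmult h (nabla X Y)"
  and nabla_vadd: "X \<in> VF \<Longrightarrow> Y \<in> VF \<Longrightarrow> Y' \<in> VF
    \<Longrightarrow> nabla X (vadd Y Y') = vadd (nabla X Y) (nabla X Y')"
  and nabla_vmult: "X \<in> VF \<Longrightarrow> Y \<in> VF \<Longrightarrow> h \<in> SF
    \<Longrightarrow> nabla X (vmult h Y) = vadd (vmult (X h) Y) (vmult h (nabla X Y))"
  using tw by (simp_all add: tanaka_webster_def affine_connection_def)

lemma nabla_eta: "X \<in> VF \<Longrightarrow> Y \<in> VF \<Longrightarrow> X (eta M Y) p = eta M (nabla X Y) p"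
  and nabla_reeb: "X \<in> VF \<Longrightarrow> nabla X (reeb M) = vzero"
  and nabla_g: "X \<in> VF \<Longrightarrow> Y \<in> VF \<Longrightarrow> Z \<in> VF
    \<Longrightarrow> X (g Y Z) p = g (nabla X Y) Z p + g Y (nabla X Z) p"
  and nabla_J: "X \<in> VF \<Longrightarrow> Y \<in> VF \<Longrightarrow> nabla X (J Y) = J (nabla X Y)"
  and torsion_HF: "X \<in> HF \<Longrightarrow> Y \<in> HF \<Longrightarrow> torsion nabla X Y = vmult (deta M X Y) (reeb M)"
  and torsion_reeb: "Y \<in> VF \<Longrightarrow> torsion nabla (reeb M) Y = vmult (\<lambda>p. - 1 / 2)
    (J (vsub (bracket (reeb M) (J Y)) (J (bracket (reeb M) Y))))"
  using tw by (simp_all add: tanaka_webster_def)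

lemma nabla_uminus: "X \<in> VF \<Longrightarrow> Y \<in> VF \<Longrightarrow> nabla X (vmult (\<lambda>p. - 1) Y) = vmult (\<lambda>p. - 1) (nabla X Y)"
  by (simp add: nabla_vmult smooth_const) (simp add: vadd_def vmult_def vf_const)

lemma nabla_vsub: "X \<in> VF \<Longrightarrow> Y \<in> VF \<Longrightarrow> Y' \<in> VF
    \<Longrightarrow> nabla X (vsub Y Y') = vsub (nabla X Y) (nabla X Y')"
  by (simp add: vsub_eq nabla_vadd nabla_uminus vmult_vf smooth_const)

lemma nabla_vsub_left: "X \<in> VF \<Longrightarrow> X' \<in> VF \<Longrightarrow> Y \<in> VF
    \<Longrightarrow> nabla (vsub X X') Y = vsub (nabla X Y) (nabla X' Y)"
  by (simp add: vsub_eq nabla_vadd_left nabla_vmult_left vmult_vf smooth_const)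

lemma nabla_HF: "X \<in> VF \<Longrightarrow> Y \<in> HF \<Longrightarrow> nabla X Y \<in> HF"
proof -
  assume X: "X \<in> VF" and Y: "Y \<in> HF"
  have "eta M Y = (\<lambda>p. 0)" using eta_HF[OF Y] by auto
  then show "nabla X Y \<in> HF"
    using nabla_eta[OF X HF_vf[OF Y]] vf_const[OF X] nabla_vf[OF X HF_vf[OF Y]]
    by (simp add: HF_iff)
qed

lemma R_vf: "X \<in> VF \<Longrightarrow> Y \<in> VF \<Longrightarrow> Z \<in> VF \<Longrightarrow> R X Y Z \<in> VF"
  unfolding curv_def by (intro vf_closed nabla_vf)

lemma R_HF: "X \<in> VF \<Longrightarrow> Y \<in> VF \<Longrightarrow> Z \<in> HF \<Longrightarrow> R X Y Z \<in> HF"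
  unfolding curv_def by (intro HF_closed nabla_HF bracket_vf)

lemma R_J: "X \<in> VF \<Longrightarrow> Y \<in> VF \<Longrightarrow> Z \<in> VF \<Longrightarrow> R X Y (J Z) = J (R X Y Z)"
  by (simp add: curv_def nabla_J J_vsub vf_closed nabla_vf)

lemma R_swap:
  assumes "X \<in> VF" "Y \<in> VF" "Z \<in> VF"
  shows "R X Y Z = vmult (\<lambda>p. - 1) (R Y X Z)"
proof -
  have "nabla (bracket X Y) Z = vmult (\<lambda>p. - 1) (nabla (bracket Y X) Z)"
    by (subst bracket_swap) (simp add: nabla_vmult_left assms bracket_vf smooth_const)
  then show ?thesis by (simp add: curv_def vsub_def vmult_def algebra_simps)
qed

lemma R_vadd_left:
  "X \<in> VF \<Longrightarrow> X' \<in> VF \<Longrightarrow> Y \<in> VF \<Longrightarrow> Z \<in> VF \<Longrightarrow> R (vadd X X') Y Z = vadd (R X Y Z) (R X' Y Z)"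
  by (simp add: curv_def nabla_vadd_left nabla_vadd bracket_vadd_left nabla_vf bracket_vf)
    (simp add: vadd_def vsub_def algebra_simps)

lemma R_vmult_left:
  assumes X: "X \<in> VF" and Y: "Y \<in> VF" and Z: "Z \<in> VF" and h: "h \<in> SF"
  shows "R (vmult h X) Y Z = vmult h (R X Y Z)"
proof -
  have "R (vmult h X) Y Z = vsub (vsub (vmult h (nabla X (nabla Y Z)))
      (vadd (vmult (Y h) (nabla X Z)) (vmult h (nabla Y (nabla X Z)))))
      (vsub (vmult h (nabla (bracket X Y) Z)) (vmult (Y h) (nabla X Z)))"
    using assms
    by (simp add: curv_def nabla_vmult_left nabla_vmult nabla_vf bracket_vmult_left
        nabla_vsub_left vf_closed vf_smooth[OF Y h])
  then show ?thesis by (simp add: curv_def vadd_def vsub_def vmult_def algebra_simps)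
qed

lemma R_vadd:
  "X \<in> VF \<Longrightarrow> Y \<in> VF \<Longrightarrow> Z \<in> VF \<Longrightarrow> Z' \<in> VF \<Longrightarrow> R X Y (vadd Z Z') = vadd (R X Y Z) (R X Y Z')"
  by (simp add: curv_def nabla_vadd nabla_vf bracket_vf) (simp add: vadd_def vsub_def algebra_simps)

lemma R_vmult:
  assumes X: "X \<in> VF" and Y: "Y \<in> VF" and Z: "Z \<in> VF" and h: "h \<in> SF"
  shows "R X Y (vmult h Z) = vmult h (R X Y Z)"
proof -
  have *: "nabla V (nabla W (vmult h Z)) = vadd (vadd (vmult (V (W h)) Z) (vmult (W h) (nabla V Z)))
      (vadd (vmult (V h) (nabla W Z)) (vmult h (nabla V (nabla W Z))))"
    if V: "V \<in> VF" and W: "W \<in> VF" for V W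
    using V W Z h vf_smooth[OF W h] by (simp add: nabla_vmult nabla_vadd nabla_vf vmult_vf)
  have "nabla (bracket X Y) (vmult h Z)
      = vadd (vmult (bracket X Y h) Z) (vmult h (nabla (bracket X Y) Z))"
    using assms by (simp add: nabla_vmult bracket_vf)
  then show ?thesis
    unfolding curv_def *[OF X Y] *[OF Y X]
    by (simp add: bracket_def vadd_def vsub_def vmult_def algebra_simps)
qed

text \<open>The operator XY - YX - [X,Y] kills the function \<open>g Z W\<close>. Expanding by
  metric compatibility, the mixed first-order terms are symmetric in X and Y and cancel, leaving the
  two curvature terms.\<close>

lemma g_R_skew:
  assumes X: "X \<in> VF" and Y: "Y \<in> VF" and Z: "Z \<in> VF" and W: "W \<in> VF"
  shows "g (R X Y Z) W p = - g Z (R X Y W) p"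
proof -
  have *: "V (V' (g Z W)) p = g (nabla V (nabla V' Z)) W p + g (nabla V' Z) (nabla V W) p
      + (g (nabla V Z) (nabla V' W) p + g Z (nabla V (nabla V' W)) p)"
    if V: "V \<in> VF" and V': "V' \<in> VF" for V V'
  proof -
    have "V' (g Z W) = (\<lambda>p. g (nabla V' Z) W p + g Z (nabla V' W) p)"
      by (rule ext) (rule nabla_g[OF V' Z W])
    then show ?thesis
      using vf_add[OF V g_smooth[OF nabla_vf[OF V' Z] W] g_smooth[OF Z nabla_vf[OF V' W]]]
      by (simp add: nabla_g V V' Z W nabla_vf)
  qed
  have "bracket X Y (g Z W) p = g (nabla (bracket X Y) Z) W p + g Z (nabla (bracket X Y) W) p"
    by (rule nabla_g[OF bracket_vf[OF X Y] Z W])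
  then have "X (Y (g Z W)) p - Y (X (g Z W)) p
      = g (nabla (bracket X Y) Z) W p + g Z (nabla (bracket X Y) W) p"
    by (simp add: bracket_def)
  then show ?thesis
    unfolding *[OF X Y] *[OF Y X] using assms
    by (simp add: curv_def g_simps nabla_vf vf_closed)
qed

section \<open>Invariance under the Reeb field and the algebra of the Webster torsion\<close>

lemma eta_bracket:
  assumes "X \<in> HF" "Y \<in> HF"
  shows "eta M (bracket X Y) p = - deta M X Y p"
proof -
  have "eta M X = (\<lambda>p. 0)" "eta M Y = (\<lambda>p. 0)" using assms eta_HF by blast+
  then show ?thesis using assms by (simp add: deta_def vf_const[OF HF_vf])
qed

lemma eta_bracket_reeb:
  assumes "Y \<in> VF"
  shows "eta M (bracket (reeb M) Y) p = reeb M (eta M Y) p"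
proof -
  have "eta M (reeb M) = (\<lambda>p. 1)" using eta_reeb by blast
  then show ?thesis using deta_reeb[OF assms, of p] by (simp add: deta_def vf_const[OF assms])
qed

lemma bracket_reeb_HF:
  assumes Y: "Y \<in> HF"
  shows "bracket (reeb M) Y \<in> HF"
proof -
  have "eta M Y = (\<lambda>p. 0)" using Y eta_HF by blast
  then show ?thesis using eta_bracket_reeb[OF HF_vf[OF Y]]
    by (simp add: HF_iff bracket_vf[OF reeb_vf HF_vf[OF Y]] vf_const[OF reeb_vf])
qed

text \<open>The Lie derivative of d\<eta> along \<xi> vanishes. On horizontal fields d\<eta> is
  minus \<eta> of the bracket, and \<eta> of a bracket with \<xi> is differentiation along \<xi>, so
  this is the Jacobi identity with \<eta> applied.\<close>

lemma lie_reeb_deta: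
  assumes Y: "Y \<in> HF" and Z: "Z \<in> HF"
  shows "reeb M (deta M Y Z) p = deta M (bracket (reeb M) Y) Z p + deta M Y (bracket (reeb M) Z) p"
proof -
  let ?x = "reeb M"
  note vf = reeb_vf HF_vf[OF Y] HF_vf[OF Z]
  have "deta M Y Z = (\<lambda>p. - eta M (bracket Y Z) p)" using eta_bracket[OF Y Z] by auto
  then have "?x (deta M Y Z) p = - ?x (eta M (bracket Y Z)) p"
    by (simp add: vf_uminus[OF reeb_vf] eta_smooth bracket_vf vf)
  also have "\<dots> = - eta M (bracket ?x (bracket Y Z)) p"
    by (simp add: eta_bracket_reeb bracket_vf vf)
  also have "bracket ?x (bracket Y Z) = vadd (bracket (bracket ?x Y) Z) (bracket Y (bracket ?x Z))"
  proof (intro ext)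
    fix f q
    have "bracket Y (bracket Z ?x) f q = - bracket Y (bracket ?x Z) f q"
    proof (cases "f \<in> SF")
      case True
      have *: "bracket Z ?x h = (\<lambda>q. - bracket ?x Z h q)" for h by (simp add: bracket_def)
      have "bracket ?x Z f \<in> SF" by (rule vf_smooth[OF bracket_vf[OF vf(1,3)] True])
      then show ?thesis by (simp add: bracket_def[of Y] * vf_uminus[OF vf(2)])
    next
      case False
      then show ?thesis
        by (simp add: vf_nonsmooth[OF bracket_vf[OF vf(2) bracket_vf[OF vf(3,1)]]]
            vf_nonsmooth[OF bracket_vf[OF vf(2) bracket_vf[OF vf(1,3)]]])
    qed
    then show "bracket ?x (bracket Y Z) f q
        = vadd (bracket (bracket ?x Y) Z) (bracket Y (bracket ?x Z)) f q"
      using jacobi[OF vf, of f q] by (simp add: vadd_def bracket_def[of Z "bracket ?x Y"]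
          bracket_def[of "bracket ?x Y" Z])
  qed
  finally show ?thesis
    by (simp add: eta_vadd bracket_vf vf eta_bracket bracket_reeb_HF Y Z)
qed

lemma tau_eq:
  assumes Y: "Y \<in> HF"
  shows "tau Y = vmult (\<lambda>p. - 1 / 2) (vadd (J (bracket (reeb M) (J Y))) (bracket (reeb M) Y))"
  using bracket_reeb_HF[OF Y] bracket_reeb_HF[OF J_HF[OF Y]] torsion_reeb[OF HF_vf[OF Y]]
  by (simp add: tau_def J_vsub HF_vf J_HF J_J) (simp add: vsub_def vadd_def vzero_def)

lemma tau_HF: "Y \<in> HF \<Longrightarrow> tau Y \<in> HF"
  by (simp add: tau_eq HF_closed J_HF bracket_reeb_HF smooth_const)

lemma g_tau:
  assumes Y: "Y \<in> HF" and Z: "Z \<in> HF"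
  shows "g (tau Y) Z p
    = - (deta M (bracket (reeb M) (J Y)) Z p + deta M (bracket (reeb M) Y) (J Z) p) / 2"
  using assms
  by (simp add: tau_eq g_simps HF_closed HF_vf J_HF bracket_reeb_HF smooth_const deta_g g_J field_simps)

text \<open>Differentiate d\<eta>(JY, Z) + d\<eta>(Y, JZ) = 0 along \<xi>, using the
  \<xi>-invariance of d\<eta>; by \<open>g_tau\<close> the four resulting terms are exactly the two
  sides.\<close>

lemma g_tau_sym:
  assumes Y: "Y \<in> HF" and Z: "Z \<in> HF"
  shows "g (tau Y) Z p = g (tau Z) Y p"
proof -
  let ?x = "reeb M"
  note b = bracket_reeb_HF J_HF Y Z
  have "deta M (J Y) Z = (\<lambda>p. - deta M Y (J Z) p)"
    by (simp add: deta_g b g_J_left fun_eq_iff)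
  moreover have "deta M Y (J Z) \<in> SF"
    using g_smooth[OF HF_vf HF_vf, OF Y Z] g_deta[OF Y] by (metis ext)
  ultimately have "?x (deta M (J Y) Z) p + ?x (deta M Y (J Z)) p = 0"
    by (simp add: vf_uminus[OF reeb_vf])
  moreover have "?x (deta M (J Y) Z) p
      = deta M (bracket ?x (J Y)) Z p - deta M (bracket ?x Z) (J Y) p"
    using deta_skew[of "J Y" "bracket ?x Z" p] by (simp add: lie_reeb_deta b)
  moreover have "?x (deta M Y (J Z)) p
      = deta M (bracket ?x Y) (J Z) p - deta M (bracket ?x (J Z)) Y p"
    using deta_skew[of Y "bracket ?x (J Z)" p] by (simp add: lie_reeb_deta b)
  ultimately show ?thesis by (simp add: g_tau Y Z)
qed

text \<open>This is \<tau>J = - J\<tau>, because J is skew for the metric on H. It follows by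
  inserting J^2 = - 1 into the formula for \<tau>.\<close>

lemma g_tau_J:
  assumes Y: "Y \<in> HF" and Z: "Z \<in> HF"
  shows "g (tau (J Y)) Z p = g (tau Y) (J Z) p"
proof -
  let ?x = "reeb M"
  have "bracket ?x (J (J Y)) = vsub vzero (bracket ?x Y)"
  proof (intro ext)
    fix f q
    show "bracket ?x (J (J Y)) f q = vsub vzero (bracket ?x Y) f q"
    proof (cases "f \<in> SF")
      case True
      then show ?thesis
        using vf_uminus[OF reeb_vf vf_smooth[OF HF_vf[OF Y] True]]
        by (simp add: J_J[OF Y] bracket_def vsub_def vzero_def)
    next
      case False
      then show ?thesis
        using vf_nonsmooth[OF bracket_vf[OF reeb_vf HF_vf[OF J_HF[OF J_HF[OF Y]]]]]
          vf_nonsmooth[OF bracket_vf[OF reeb_vf HF_vf[OF Y]]]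
        by (simp add: vsub_def vzero_def)
    qed
  qed
  then show ?thesis
    using Y Z bracket_reeb_HF[OF Y]
    by (simp add: g_tau J_HF deta_g HF_closed J_vsub J_vzero g_simps vf_closed HF_vf
        bracket_reeb_HF J_J g_J J_vf)
qed

text \<open>Needed for \<open>V\<close> a bracket of horizontal fields, which is in general not
  horizontal. Torsion is tensorial, so split \<open>V\<close>: the horizontal part contributes a
  multiple of \<xi>, orthogonal to \<open>W\<close>, and the vertical part contributes T(X, \<xi>) =
  - \<tau>(X).\<close>

lemma torsion_general:
  assumes X: "X \<in> HF" and V: "V \<in> VF" and W: "W \<in> HF"
  shows "g (torsion nabla X V) W p = - eta M V p * g (tau X) W p"
proof -
  let ?V = "hproj M V"
  have h: "?V \<in> HF" by (rule hproj_HF[OF V])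
  have Vd: "V = vadd ?V (vmult (eta M V) (reeb M))" by (rule hproj_decomp)
  note vf = HF_vf[OF X] HF_vf[OF h] HF_vf[OF W] reeb_vf eta_smooth[OF V]
  have br: "bracket X V = vadd (bracket X ?V)
      (vadd (vmult (X (eta M V)) (reeb M)) (vmult (eta M V) (bracket X (reeb M))))"
  proof -
    have "bracket V X = vadd (bracket ?V X) (bracket (vmult (eta M V) (reeb M)) X)"
      by (subst Vd) (intro bracket_vadd_left vf vf_closed)
    also have "bracket (vmult (eta M V) (reeb M)) X
        = vsub (vmult (eta M V) (bracket (reeb M) X)) (vmult (X (eta M V)) (reeb M))"
      by (intro bracket_vmult_left vf)
    finally show ?thesis
      unfolding bracket_swap[of X V] bracket_swap[of X ?V] bracket_swap[of X "reeb M"]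
      by (simp add: vadd_def vsub_def vmult_def algebra_simps)
  qed
  have n1: "nabla X V = vadd (nabla X ?V) (vmult (X (eta M V)) (reeb M))"
    by (subst Vd) (simp add: nabla_vadd nabla_vmult nabla_reeb vf vf_closed,
        simp add: vadd_def vmult_def vzero_def)
  have n2: "nabla V X = vadd (nabla ?V X) (vmult (eta M V) (nabla (reeb M) X))"
    by (subst Vd) (simp add: nabla_vadd_left nabla_vmult_left vf vf_closed)
  have "tau X = vsub (nabla (reeb M) X) (bracket (reeb M) X)"
    unfolding tau_def torsion_def nabla_reeb[OF vf(1)] by (simp add: vsub_def vzero_def)
  then have "torsion nabla X V
      = vsub (torsion nabla X ?V) (vmult (eta M V) (tau X))"
    unfolding torsion_def br n1 n2 bracket_swap[of X "reeb M"]
    by (simp add: vadd_def vsub_def vmult_def algebra_simps)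
  also have "torsion nabla X ?V = vmult (deta M X ?V) (reeb M)" by (rule torsion_HF[OF X h])
  finally have "torsion nabla X V = vsub (vmult (deta M X ?V) (reeb M)) (vmult (eta M V) (tau X))" .
  moreover have "deta M X ?V \<in> SF"
    using deta_g[OF X h] g_smooth[OF HF_vf[OF J_HF[OF X]] HF_vf[OF h]] by (metis ext)
  ultimately show ?thesis
    using W by (simp add: g_simps vf vf_closed HF_vf[OF tau_HF[OF X]] g_reeb(1))
qed

text \<open>First Bianchi identity with torsion. Differentiating T(B, C) = d\<eta>(B, C) \<xi> gives
  only multiples of the parallel field \<xi>, which \<open>W\<close> does not see. The right-hand
  side comes from the torsion of A with [B, C], whose vertical component is - d\<eta>(B, C); the
  double brackets cancel by Jacobi.\<close>

lemma bianchi: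
  assumes X: "X \<in> HF" and Y: "Y \<in> HF" and Z: "Z \<in> HF" and W: "W \<in> HF"
  shows "g (R X Y Z) W p + g (R Y Z X) W p + g (R Z X Y) W p
    = deta M X Y p * g (tau Z) W p + deta M Y Z p * g (tau X) W p + deta M Z X p * g (tau Y) W p"
proof -
  have d: "deta M A B \<in> SF" if "A \<in> HF" "B \<in> HF" for A B
    using deta_g[OF that] g_smooth[OF HF_vf[OF J_HF[OF that(1)]] HF_vf[OF that(2)]] by (metis ext)
  \<comment> \<open>The nine terms of the cyclic sum, regrouped by the field A of the outer
    derivative: each group takes one term from each of the three curvatures.\<close>
  have *: "g (nabla A (nabla B C)) W p - g (nabla A (nabla C B)) W p - g (nabla (bracket B C) A) W p
      = deta M B C p * g (tau A) W p + g (bracket A (bracket B C)) W p"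
    if A: "A \<in> HF" and B: "B \<in> HF" and C: "C \<in> HF" for A B C
  proof -
    note vf = HF_vf[OF A] HF_vf[OF B] HF_vf[OF C] HF_vf[OF W] reeb_vf
    have "vsub (nabla B C) (nabla C B) = vadd (bracket B C) (vmult (deta M B C) (reeb M))"
      using torsion_HF[OF B C] by (simp add: torsion_def vsub_def vadd_def fun_eq_iff algebra_simps)
    then have "nabla A (vsub (nabla B C) (nabla C B)) = vadd (nabla A (bracket B C))
        (vadd (vmult (A (deta M B C)) (reeb M)) (vmult (deta M B C) vzero))"
      by (simp add: nabla_vadd nabla_vmult nabla_reeb vf vf_closed d B C)
    then have "vsub (nabla A (nabla B C)) (nabla A (nabla C B)) = vadd (nabla A (bracket B C))
        (vmult (A (deta M B C)) (reeb M))"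
      by (simp add: nabla_vsub vf nabla_vf) (simp add: vadd_def vmult_def vzero_def)
    then have "g (vsub (nabla A (nabla B C)) (nabla A (nabla C B))) W p
        = g (vadd (nabla A (bracket B C)) (vmult (A (deta M B C)) (reeb M))) W p" by simp
    then have "g (nabla A (nabla B C)) W p - g (nabla A (nabla C B)) W p = g (nabla A (bracket B C)) W p"
      by (simp add: g_simps vf nabla_vf vf_closed vf_smooth[OF vf(1) d[OF B C]] g_reeb(1)[OF W])
    moreover have "g (torsion nabla A (bracket B C)) W p = deta M B C p * g (tau A) W p"
      by (simp add: torsion_general A W bracket_vf vf eta_bracket B C)
    then have "g (nabla A (bracket B C)) W p - g (nabla (bracket B C) A) W p
        - g (bracket A (bracket B C)) W p = deta M B C p * g (tau A) W p"
      by (simp add: torsion_def g_simps vf nabla_vf vf_closed)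
    ultimately show ?thesis by simp
  qed
  have Rg: "g (R A B C) W p = g (nabla A (nabla B C)) W p - g (nabla B (nabla A C)) W p
      - g (nabla (bracket A B) C) W p" if "A \<in> HF" "B \<in> HF" "C \<in> HF" for A B C
    using that W by (simp add: curv_def g_simps HF_vf nabla_vf vf_closed)
  note vf = HF_vf[OF X] HF_vf[OF Y] HF_vf[OF Z]
  note bv = bracket_vf[OF vf(1) bracket_vf[OF vf(2,3)]] bracket_vf[OF vf(2) bracket_vf[OF vf(3,1)]]
    bracket_vf[OF vf(3) bracket_vf[OF vf(1,2)]]
  have "vadd (vadd (bracket X (bracket Y Z)) (bracket Y (bracket Z X))) (bracket Z (bracket X Y)) = vzero"
    by (simp add: fun_eq_iff vadd_def vzero_def jacobi[OF vf])
  then have "g (vadd (vadd (bracket X (bracket Y Z)) (bracket Y (bracket Z X))) (bracket Z (bracket X Y))) W p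
      = 0"
    using g_vzero(2)[OF HF_vf[OF W]] by simp
  then have "g (bracket X (bracket Y Z)) W p + g (bracket Y (bracket Z X)) W p
      + g (bracket Z (bracket X Y)) W p = 0"
    by (simp add: g_simps bv vf_closed HF_vf W)
  then show ?thesis
    using *[OF X Y Z] *[OF Y Z X] *[OF Z X Y] unfolding Rg[OF X Y Z] Rg[OF Y Z X] Rg[OF Z X Y]
    by linarith
qed

end

section \<open>The Ricci form in an adapted frame\<close>

locale tanaka_webster_frame = contact_frame M U E + tanaka_webster_manifold M nabla
  for M :: "'a::{t2_space,second_countable_topology} contact_data" and U E nabla
begin

text \<open>Curvature commutes with J, and i times this number is its trace as a complex
  endomorphism of (H, J): the Ricci form.\<close>

definition rho :: "'a vf \<Rightarrow> 'a vf \<Rightarrow> 'a \<Rightarrow> real" where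
  "rho X Y p = g (R X Y (E 1)) (E 2) p + g (R X Y (E 3)) (E 4) p"

text \<open>Conceptually, let Q(X, Y) be the sum over k of g(R(X, e_k)Y, e_k). Contracting the
  Bianchi identity with W = Je_k gives 2 rho(X, Y) = Q(Y, JX) - Q(X, JY), the torsion terms
  cancelling by symmetry of \<tau>. Contracting with W = e_k shows Q symmetric, since \<tau> is
  symmetric, anticommutes with J and hence is trace-free. So rho is J-invariant, which is the
  content of the last two clauses, and the first follows since the trace of Q is - s. The proof does
  this in components.\<close>

lemma rho_frame:
  assumes p: "p \<in> U" and s: "has_scalar_curvature M nabla s"
  shows "rho (E 1) (E 2) p + rho (E 3) (E 4) p = - s p / 2"
    and "rho (E 1) (E 3) p = rho (E 2) (E 4) p"
    and "rho (E 1) (E 4) p = - rho (E 2) (E 3) p"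
proof -
  note One_nat_def [simp del]
  define r where "r i j k l = g (R (E i) (E j) (E k)) (E l) p" for i j k l
  define t where "t i j = g (tau (E i)) (E j) p" for i j
  define d where "d i j = deta M (E i) (E j) p" for i j
  let ?I = "{1..4::nat}"
  note vf = HF_vf[OF E_HF]
  have swap: "r i j k l = - r j i k l" if "i \<in> ?I" "j \<in> ?I" "k \<in> ?I" "l \<in> ?I" for i j k l
    unfolding r_def R_swap[OF vf[OF that(1)] vf[OF that(2)] vf[OF that(3)]]
    using that by (simp add: g_simps vf R_vf smooth_const)
  have skew: "r i j k l = - r i j l k" if "i \<in> ?I" "j \<in> ?I" "k \<in> ?I" "l \<in> ?I" for i j k l
    using g_R_skew[OF vf[OF that(1)] vf[OF that(2)] vf[OF that(3)] vf[OF that(4)], of p]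
      g_sym[OF vf[OF that(3)] R_vf[OF vf[OF that(1)] vf[OF that(2)] vf[OF that(4)]], of p]
    by (simp add: r_def)
  have RE: "R (E i) (E j) (E k) \<in> HF" if "i \<in> ?I" "j \<in> ?I" "k \<in> ?I" for i j k
    using that by (simp add: R_HF vf E_HF)
  \<comment> \<open>R commutes with J and J is an isometry of H, so the last index pairs 24 and 23
    reduce to 13 and 14.\<close>
  have J24: "r i j 2 4 = r i j 1 3" if "i \<in> ?I" "j \<in> ?I" for i j
    unfolding r_def E_2 E_4 using that RE[of i j 1]
    by (simp add: R_J vf E_HFs g_J)
  have J23: "r i j 2 3 = - r i j 1 4" if "i \<in> ?I" "j \<in> ?I" for i j
    unfolding r_def E_2 E_4 using that RE[of i j 1]
    by (simp add: R_J vf E_HFs g_J_left)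
  have bi: "r i j k l + r j k i l + r k i j l = d i j * t k l + d j k * t i l + d k i * t j l"
    if "i \<in> ?I" "j \<in> ?I" "k \<in> ?I" "l \<in> ?I" for i j k l
    unfolding r_def d_def t_def by (intro bianchi E_HF that)
  have dg: "d i j = g (J (E i)) (E j) p" if "i \<in> ?I" "j \<in> ?I" for i j
    using that by (simp add: d_def deta_g E_HF)
  have d_val: "d 1 2 = 1" "d 2 1 = -1" "d 3 4 = 1" "d 4 3 = -1" "d 1 3 = 0" "d 3 1 = 0" "d 1 4 = 0"
    "d 4 1 = 0" "d 2 3 = 0" "d 3 2 = 0" "d 2 4 = 0" "d 4 2 = 0"
    using p by (simp_all add: dg JE g_simps vf vzero_vf E_orth)
  have t_sym: "t i j = t j i" if "i \<in> ?I" "j \<in> ?I" for i j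
    unfolding t_def by (intro g_tau_sym E_HF that)
  have t_J: "t 2 2 = - t 1 1" "t 2 3 = t 1 4" "t 2 4 = - t 1 3" "t 4 4 = - t 3 3"
    unfolding t_def using g_tau_J[OF E_HFs(1), of _ p] g_tau_J[OF E_HFs(4), of _ p]
    by (simp_all add: JE g_simps vf vf_closed E_HFs HF_vf[OF tau_HF] E_2[symmetric] E_4[symmetric])
  \<comment> \<open>These rules give a normal form: the first index pair increasing, the last pair
    one of 12, 13, 14, 34, and \<tau> reduced to the components 11, 12, 13, 14, 33, 34.\<close>
  note r_swap = swap[of 2 1] swap[of 3 1] swap[of 4 1] swap[of 3 2] swap[of 4 2] swap[of 4 3]
  have r_skew: "r i j 2 1 = - r i j 1 2" "r i j 3 1 = - r i j 1 3" "r i j 4 1 = - r i j 1 4"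
    "r i j 3 2 = r i j 1 4" "r i j 4 2 = - r i j 1 3" "r i j 4 3 = - r i j 3 4"
    if "i \<in> ?I" "j \<in> ?I" for i j
    using that skew[of i j 2 1] skew[of i j 3 1] skew[of i j 4 1] skew[of i j 3 2] skew[of i j 4 2]
      skew[of i j 4 3] J23[of i j] J24[of i j] by simp_all
  have r_diag: "r i j k k = 0" "r k k i j = 0" if "i \<in> ?I" "j \<in> ?I" "k \<in> ?I" for i j k
    using that skew[of i j k k] swap[of k k i j] by simp_all
  note t_sw = t_sym[of 2 1] t_sym[of 3 1] t_sym[of 4 1] t_sym[of 3 2] t_sym[of 4 2] t_sym[of 4 3]
  note rules = r_swap r_skew J23 J24 r_diag t_sw t_J d_val
  \<comment> \<open>One relation for each triple of distinct indices and each \<open>l\<close>; in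
    normal form the three claims are linear consequences of these sixteen.\<close>
  have b: "r 1 2 3 l + r 2 3 1 l + r 3 1 2 l = d 1 2 * t 3 l + d 2 3 * t 1 l + d 3 1 * t 2 l"
    "r 1 2 4 l + r 2 4 1 l + r 4 1 2 l = d 1 2 * t 4 l + d 2 4 * t 1 l + d 4 1 * t 2 l"
    "r 1 3 4 l + r 3 4 1 l + r 4 1 3 l = d 1 3 * t 4 l + d 3 4 * t 1 l + d 4 1 * t 3 l"
    "r 2 3 4 l + r 3 4 2 l + r 4 2 3 l = d 2 3 * t 4 l + d 3 4 * t 2 l + d 4 2 * t 3 l"
    if "l \<in> ?I" for l
    by (rule bi; use that in simp)+
  note b1 = b[of 1, simplified rules, simplified] and b2 = b[of 2, simplified rules, simplified]
    and b3 = b[of 3, simplified rules, simplified] and b4 = b[of 4, simplified rules, simplified]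
  have s_eq: "s p = (\<Sum>a=1..4. \<Sum>b=1..4. r b a a b)"
    using s frame p unfolding has_scalar_curvature_def r_def by blast
  have rho: "rho (E i) (E j) p = r i j 1 2 + r i j 3 4" for i j by (simp add: rho_def r_def)
  show "rho (E 1) (E 2) p + rho (E 3) (E 4) p = - s p / 2"
    using b1 b2 b3 b4 unfolding s_eq sum_1_4 rho by (simp add: rules)
  show "rho (E 1) (E 3) p = rho (E 2) (E 4) p"
    using b1 b2 b3 b4 unfolding rho by (simp add: rules)
  show "rho (E 1) (E 4) p = - rho (E 2) (E 3) p"
    using b1 b2 b3 b4 unfolding rho by (simp add: rules)
qed

end

subsection \<open>Forms of type (0,2) and the curvature of the determinant bundle\<close>

lemma re_im_vf [simp]:
  "re_vf (complex_vf X Y) = X" "im_vf (complex_vf X Y) = Y"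
  "re_vf (vadd Z W) = vadd (re_vf Z) (re_vf W)" "im_vf (vadd Z W) = vadd (im_vf Z) (im_vf W)"
  "re_vf (vsub Z W) = vsub (re_vf Z) (re_vf W)" "im_vf (vsub Z W) = vsub (im_vf Z) (im_vf W)"
  "re_vf (vmult u Z) = vsub (vmult (\<lambda>p. Re (u p)) (re_vf Z)) (vmult (\<lambda>p. Im (u p)) (im_vf Z))"
  "im_vf (vmult u Z) = vadd (vmult (\<lambda>p. Re (u p)) (im_vf Z)) (vmult (\<lambda>p. Im (u p)) (re_vf Z))"
  by (simp_all add: re_vf_def im_vf_def complex_vf_def vadd_def vsub_def vmult_def)

abbreviation cvf :: "'a vf \<Rightarrow> 'a cvf" where "cvf X \<equiv> complex_vf X vzero"

lemma cvf_decomp: "Z = vadd (cvf (re_vf Z)) (vmult (\<lambda>p. \<i>) (cvf (im_vf Z)))"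
  by (simp add: re_vf_def im_vf_def complex_vf_def vadd_def vmult_def vzero_def fun_eq_iff
      complex_eq_iff)

lemma cvf_vadd: "cvf (vadd X Y) = vadd (cvf X) (cvf Y)"
  and cvf_vmult: "cvf (vmult h X) = vmult (\<lambda>p. complex_of_real (h p)) (cvf X)"
  by (simp_all add: complex_vf_def vadd_def vmult_def vzero_def fun_eq_iff complex_eq_iff)

context smooth_data
begin

lemma smooth_Re: "u \<in> smooth_fun M \<Longrightarrow> (\<lambda>p. Re (u p)) \<in> smooth_fun M"
  and smooth_Im: "u \<in> smooth_fun M \<Longrightarrow> (\<lambda>p. Im (u p)) \<in> smooth_fun M"
  and smooth_of_real: "h \<in> smooth_fun M \<Longrightarrow> (\<lambda>p. complex_of_real (h p)) \<in> smooth_fun M"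
  by (rule smooth_linear[OF atlas bounded_linear_Re] smooth_linear[OF atlas bounded_linear_Im]
      smooth_linear[OF atlas bounded_linear_of_real], assumption)+

lemma smooth_Complex:
  "h \<in> smooth_fun M \<Longrightarrow> k \<in> smooth_fun M \<Longrightarrow> (\<lambda>p. Complex (h p) (k p)) \<in> smooth_fun M"
  unfolding Complex_eq by (intro smooth_ring smooth_of_real)

lemma cderiv_smooth:
  assumes "X \<in> vector_fields M" "u \<in> smooth_fun M"
  shows "cderiv X u \<in> smooth_fun M"
  unfolding cderiv_def[abs_def]
  by (intro smooth_Complex vf_smooth[OF assms(1)] smooth_Re smooth_Im assms(2))

lemma cderiv_diff:
  assumes "X \<in> vector_fields M" "u \<in> smooth_fun M" "v \<in> smooth_fun M"
  shows "cderiv X (\<lambda>p. u p - v p) p = cderiv X u p - cderiv X v p"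
  using assms
  by (simp add: cderiv_def vf_diff[OF assms(1)] smooth_Re smooth_Im complex_eq_iff)

lemma cderiv_bracket: "cderiv (bracket X Y) u p = cderiv X (cderiv Y u) p - cderiv Y (cderiv X u) p"
  by (simp add: cderiv_def bracket_def complex_eq_iff)

end

context contact_metric
begin

lemma HC_iff: "Z \<in> HC M \<longleftrightarrow> re_vf Z \<in> HF \<and> im_vf Z \<in> HF"
  by (simp add: HC_def)

lemma HC_closed:
  "Z \<in> HC M \<Longrightarrow> W \<in> HC M \<Longrightarrow> vadd Z W \<in> HC M"
  "Z \<in> HC M \<Longrightarrow> W \<in> HC M \<Longrightarrow> vsub Z W \<in> HC M"
  "u \<in> smooth_fun M \<Longrightarrow> Z \<in> HC M \<Longrightarrow> vmult u Z \<in> HC M"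
  "X \<in> HF \<Longrightarrow> Y \<in> HF \<Longrightarrow> complex_vf X Y \<in> HC M"
  by (auto simp: HC_iff HF_closed smooth_Re smooth_Im)

lemma cvf_HC: "X \<in> HF \<Longrightarrow> cvf X \<in> HC M"
  by (simp add: HC_closed HF_closed)

lemma T10_parts:
  assumes "Z \<in> T10 M"
  shows "J (re_vf Z) = vsub vzero (im_vf Z)" "J (im_vf Z) = re_vf Z"
proof -
  have e: "cJ M Z = vmult (\<lambda>p. \<i>) Z" using assms by (simp add: T10_def)
  have "re_vf (cJ M Z) = re_vf (vmult (\<lambda>p. \<i>) Z)" "im_vf (cJ M Z) = im_vf (vmult (\<lambda>p. \<i>) Z)"
    by (simp_all only: e)
  then show "J (re_vf Z) = vsub vzero (im_vf Z)" "J (im_vf Z) = re_vf Z"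
    by (simp_all add: cJ_def) (simp_all add: vsub_def vadd_def vmult_def vzero_def)
qed

lemma T10_I:
  assumes X: "X \<in> HF"
  shows "complex_vf X (vsub vzero (J X)) \<in> T10 M"
proof -
  let ?Z = "complex_vf X (vsub vzero (J X))"
  have "J (vsub vzero (J X)) = X"
    unfolding J_vsub[OF vzero_vf HF_vf[OF J_HF[OF X]]] J_vzero J_J[OF X]
    by (simp add: vsub_def vzero_def)
  then have "cJ M ?Z = complex_vf (J X) X" by (simp add: cJ_def)
  also have "\<dots> = vmult (\<lambda>p. \<i>) ?Z"
    by (simp add: complex_vf_def vmult_def vsub_def vzero_def fun_eq_iff complex_eq_iff)
  finally show ?thesis
    unfolding T10_def using HC_closed(4)[OF X HF_closed(3)[OF HF_closed(1) J_HF[OF X]]] by blast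
qed

context
  fixes \<omega> assumes \<omega>: "\<omega> \<in> forms02 M"
begin

lemma forms02_smooth: "Z \<in> HC M \<Longrightarrow> W \<in> HC M \<Longrightarrow> \<omega> Z W \<in> smooth_fun M"
  and forms02_skew: "Z \<in> HC M \<Longrightarrow> W \<in> HC M \<Longrightarrow> \<omega> Z W p = - \<omega> W Z p"
  and forms02_T10: "Z \<in> T10 M \<Longrightarrow> W \<in> HC M \<Longrightarrow> \<omega> Z W p = 0"
  and forms02_vadd: "Z \<in> HC M \<Longrightarrow> W \<in> HC M \<Longrightarrow> W' \<in> HC M
    \<Longrightarrow> \<omega> Z (vadd W W') p = \<omega> Z W p + \<omega> Z W' p"
  and forms02_vmult: "Z \<in> HC M \<Longrightarrow> W \<in> HC M \<Longrightarrow> u \<in> smooth_fun M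
    \<Longrightarrow> \<omega> Z (vmult u W) p = u p * \<omega> Z W p"
  using \<omega> unfolding forms02_def clinear_on_HC_def by blast+

lemma forms02_vsub: "Z \<in> HC M \<Longrightarrow> W \<in> HC M \<Longrightarrow> W' \<in> HC M
    \<Longrightarrow> \<omega> Z (vsub W W') p = \<omega> Z W p - \<omega> Z W' p"
  by (simp add: vsub_eq forms02_vadd forms02_vmult HC_closed smooth_const)

lemma forms02_left:
  "Z \<in> HC M \<Longrightarrow> W \<in> HC M \<Longrightarrow> W' \<in> HC M \<Longrightarrow> \<omega> (vadd W W') Z p = \<omega> W Z p + \<omega> W' Z p"
  "Z \<in> HC M \<Longrightarrow> W \<in> HC M \<Longrightarrow> W' \<in> HC M \<Longrightarrow> \<omega> (vsub W W') Z p = \<omega> W Z p - \<omega> W' Z p"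
  "Z \<in> HC M \<Longrightarrow> W \<in> HC M \<Longrightarrow> u \<in> smooth_fun M \<Longrightarrow> \<omega> (vmult u W) Z p = u p * \<omega> W Z p"
  using forms02_vadd forms02_vsub forms02_vmult HC_closed by (simp_all add: forms02_skew[of _ Z])

text \<open>X - iJX is of type (1,0), so the form annihilates it.\<close>

lemma forms02_J:
  assumes X: "X \<in> HF" and Z: "Z \<in> HC M"
  shows "\<omega> (cvf (J X)) Z p = - \<i> * \<omega> (cvf X) Z p"
proof -
  note c = cvf_HC[OF X] cvf_HC[OF J_HF[OF X]]
  have "complex_vf X (vsub vzero (J X)) = vsub (cvf X) (vmult (\<lambda>p. \<i>) (cvf (J X)))"
    by (simp add: complex_vf_def vsub_def vmult_def vzero_def fun_eq_iff complex_eq_iff)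
  then have "\<omega> (vsub (cvf X) (vmult (\<lambda>p. \<i>) (cvf (J X)))) Z p = 0"
    using forms02_T10[OF T10_I[OF X] Z] by simp
  then have "\<omega> (cvf X) Z p = \<i> * \<omega> (cvf (J X)) Z p"
    by (simp add: forms02_left Z c HC_closed smooth_const)
  then show ?thesis by simp
qed

lemma forms02_parts:
  assumes Z: "Z \<in> HC M" and W: "W \<in> HC M"
  shows "\<omega> Z W p = \<omega> (cvf (re_vf Z)) (cvf (re_vf W)) p - \<omega> (cvf (im_vf Z)) (cvf (im_vf W)) p
    + \<i> * (\<omega> (cvf (re_vf Z)) (cvf (im_vf W)) p + \<omega> (cvf (im_vf Z)) (cvf (re_vf W)) p)"
proof -
  have c: "cvf (re_vf Z) \<in> HC M" "cvf (im_vf Z) \<in> HC M" "cvf (re_vf W) \<in> HC M" "cvf (im_vf W) \<in> HC M"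
    using Z W by (simp_all add: HC_iff HF_closed)
  have "\<omega> Z W p = \<omega> (vadd (cvf (re_vf Z)) (vmult (\<lambda>p. \<i>) (cvf (im_vf Z))))
      (vadd (cvf (re_vf W)) (vmult (\<lambda>p. \<i>) (cvf (im_vf W)))) p"
    by (simp only: cvf_decomp[symmetric])
  then show ?thesis
    by (simp add: forms02_left forms02_vadd forms02_vmult c HC_closed smooth_const algebra_simps)
qed

end

text \<open>The \<open>\<complex>\<close>-linear extension of \<open>g\<close> in the direction \<open>F - i J F\<close>.\<close>

definition dual01 :: "'a vf \<Rightarrow> 'a cvf \<Rightarrow> 'a \<Rightarrow> complex" where
  "dual01 F Z p = Complex (g (re_vf Z) F p + g (im_vf Z) (J F) p) (g (im_vf Z) F p - g (re_vf Z) (J F) p)"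

text \<open>Supplies global (0,2)-forms. The complex bilinear metric vanishes on pairs of
  (1,0)-vectors, so pairing with F - iJF kills type (1,0).\<close>

lemma dual01_wedge_forms02:
  assumes F: "F \<in> HF" and G: "G \<in> HF"
  shows "(\<lambda>Z W p. dual01 F Z p * dual01 G W p - dual01 F W p * dual01 G Z p) \<in> forms02 M"
proof -
  have sm: "dual01 F Z \<in> smooth_fun M" if "Z \<in> HC M" "F \<in> HF" for Z F
  proof -
    have "(\<lambda>p. g (re_vf Z) F p + g (im_vf Z) (J F) p) \<in> SF"
      "(\<lambda>p. g (im_vf Z) F p - g (re_vf Z) (J F) p) \<in> SF"
      using that by (intro smooth_ring g_smooth HF_vf J_HF; simp add: HC_iff)+
    then show ?thesis unfolding dual01_def[abs_def] by (rule smooth_Complex)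
  qed
  have add: "dual01 F (vadd Z W) p = dual01 F Z p + dual01 F W p"
    if "Z \<in> HC M" "W \<in> HC M" "F \<in> HF" for Z W F p
    using that by (simp add: dual01_def HC_iff g_simps HF_vf J_HF complex_eq_iff)
  have mult: "dual01 F (vmult u Z) p = u p * dual01 F Z p"
    if "Z \<in> HC M" "u \<in> smooth_fun M" "F \<in> HF" for Z u F p
    using that
    by (simp add: dual01_def HC_iff g_simps HF_vf J_HF vf_closed smooth_Re smooth_Im complex_eq_iff
        algebra_simps)
  have T: "dual01 F Z p = 0" if Z: "Z \<in> T10 M" and F: "F \<in> HF" for Z F p
  proof -
    have h: "re_vf Z \<in> HF" "im_vf Z \<in> HF" using Z by (simp_all add: T10_def HC_iff)
    have "g (re_vf Z) (J F) p = g (im_vf Z) F p" "g (im_vf Z) (J F) p = - g (re_vf Z) F p"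
      using g_J_left[OF h(1) F, of p] g_J_left[OF h(2) F, of p] T10_parts[OF Z] h F
      by (simp_all add: g_simps HF_vf vzero_vf)
    then show ?thesis by (simp add: dual01_def complex_eq_iff)
  qed
  have HC: "Z \<in> HC M" if "Z \<in> T10 M" for Z using that by (simp add: T10_def)
  show ?thesis
    unfolding forms02_def clinear_on_HC_def
    using F G by (auto simp: add mult T algebra_simps intro!: smooth_ring sm)
qed

end

section \<open>Forms of type (0,2) in an adapted frame\<close>

context contact_frame
begin

lemma E_g: "p \<in> U \<Longrightarrow> g (E 1) (E 1) p = 1" "p \<in> U \<Longrightarrow> g (E 1) (E 2) p = 0"
  "p \<in> U \<Longrightarrow> g (E 1) (E 3) p = 0" "p \<in> U \<Longrightarrow> g (E 1) (E 4) p = 0"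
  "p \<in> U \<Longrightarrow> g (E 2) (E 1) p = 0" "p \<in> U \<Longrightarrow> g (E 2) (E 2) p = 1"
  "p \<in> U \<Longrightarrow> g (E 2) (E 3) p = 0" "p \<in> U \<Longrightarrow> g (E 2) (E 4) p = 0"
  "p \<in> U \<Longrightarrow> g (E 3) (E 1) p = 0" "p \<in> U \<Longrightarrow> g (E 3) (E 2) p = 0"
  "p \<in> U \<Longrightarrow> g (E 3) (E 3) p = 1" "p \<in> U \<Longrightarrow> g (E 3) (E 4) p = 0"
  "p \<in> U \<Longrightarrow> g (E 4) (E 1) p = 0" "p \<in> U \<Longrightarrow> g (E 4) (E 2) p = 0"
  "p \<in> U \<Longrightarrow> g (E 4) (E 3) p = 0" "p \<in> U \<Longrightarrow> g (E 4) (E 4) p = 1"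
  by (simp_all add: E_orth del: One_nat_def)

text \<open>The wedge of the (0,1)-forms e1 - i e2 and e3 - i e4 of the dual frame, evaluated on
  real vectors.\<close>

definition plucker01 :: "'a vf \<Rightarrow> 'a vf \<Rightarrow> 'a \<Rightarrow> complex" where
  "plucker01 X Y p = Complex (g X (E 1) p) (- g X (E 2) p) * Complex (g Y (E 3) p) (- g Y (E 4) p)
     - Complex (g X (E 3) p) (- g X (E 4) p) * Complex (g Y (E 1) p) (- g Y (E 2) p)"

text \<open>At a point the (0,2)-forms on H form a complex line. The statement is about an abstract
  \<open>b\<close> because it is applied both to a (0,2)-form and to the result of letting the
  curvature act on it.\<close>

lemma forms02_real_expand:
  fixes b :: "'a vf \<Rightarrow> 'a vf \<Rightarrow> complex"
  assumes p: "p \<in> U" and X: "X \<in> HF" and Y: "Y \<in> HF"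
    and skew: "\<And>X Y. X \<in> HF \<Longrightarrow> Y \<in> HF \<Longrightarrow> b X Y = - b Y X"
    and add: "\<And>X Y Z. X \<in> HF \<Longrightarrow> Y \<in> HF \<Longrightarrow> Z \<in> HF \<Longrightarrow> b X (vadd Y Z) = b X Y + b X Z"
    and mult: "\<And>X Y h. X \<in> HF \<Longrightarrow> Y \<in> HF \<Longrightarrow> h \<in> SF \<Longrightarrow> b X (vmult h Y) = h p *\<^sub>R b X Y"
    and J: "\<And>X Y. X \<in> HF \<Longrightarrow> Y \<in> HF \<Longrightarrow> b (J X) Y = - \<i> * b X Y"
  shows "b X Y = plucker01 X Y p * b (E 1) (E 3)"
proof -
  note One_nat_def [simp del]
  have ex: "b X Y = (\<Sum>j=1..4. g Y (E j) p *\<^sub>R b X (E j))" if "X \<in> HF" "Y \<in> HF" for X Y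
    by (rule tensor_expand[OF p that(2)]) (use that in \<open>simp_all add: add mult\<close>)
  have exl: "b X (E j) = - (\<Sum>i=1..4. g X (E i) p *\<^sub>R b (E j) (E i))" if "j \<in> {1..4}" for j
    using skew[OF X E_HF[OF that]] ex[OF E_HF[OF that] X] by simp
  have b2: "b (E 2) Z = - \<i> * b (E 1) Z" and b4: "b (E 4) Z = - \<i> * b (E 3) Z" if "Z \<in> HF" for Z
    unfolding E_2 E_4 by (intro J E_HFs that)+
  have b11: "b (E 1) (E 1) = 0" "b (E 3) (E 3) = 0"
    using skew[OF E_HFs(1,1)] skew[OF E_HFs(4,4)] by simp_all
  have b12: "b (E 1) (E 2) = 0" "b (E 3) (E 4) = 0"
    using skew[OF E_HFs(1,3)] skew[OF E_HFs(4,5)] b2[OF E_HFs(1)] b4[OF E_HFs(4)] b11 by simp_all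
  have b31: "b (E 3) (E 1) = - b (E 1) (E 3)" "b (E 3) (E 2) = \<i> * b (E 1) (E 3)"
    "b (E 1) (E 4) = - \<i> * b (E 1) (E 3)"
    using skew[OF E_HFs(4,1)] skew[OF E_HFs(4,3)] skew[OF E_HFs(1,5)] b2[OF E_HFs(4)]
      b4[OF E_HFs(1)] by simp_all
  show ?thesis
    unfolding ex[OF X Y] sum_1_4
    by (simp add: exl sum_1_4 b2 b4 E_HFs b11 b12 b31 plucker01_def complex_eq_iff algebra_simps)
qed

end

section \<open>Curvature of the connection on (0,2)-forms\<close>

context tanaka_webster_manifold
begin

lemma cnabla_HC: "X \<in> VF \<Longrightarrow> Z \<in> HC M \<Longrightarrow> cnabla nabla X Z \<in> HC M"
  by (simp add: cnabla_def HC_closed(4) nabla_HF HC_iff)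

definition cR :: "'a vf \<Rightarrow> 'a vf \<Rightarrow> 'a cvf \<Rightarrow> 'a cvf" where
  "cR X Y Z = complex_vf (R X Y (re_vf Z)) (R X Y (im_vf Z))"

lemma cR_eq: "cR X Y Z = vsub (vsub (cnabla nabla X (cnabla nabla Y Z)) (cnabla nabla Y (cnabla nabla X Z)))
    (cnabla nabla (bracket X Y) Z)"
  by (simp add: cR_def cnabla_def) (simp add: curv_def complex_vf_def vsub_def fun_eq_iff complex_eq_iff)

lemma cR_HC: "X \<in> VF \<Longrightarrow> Y \<in> VF \<Longrightarrow> Z \<in> HC M \<Longrightarrow> cR X Y Z \<in> HC M"
  by (simp add: cR_def HC_iff R_HF)

text \<open>Curvature acts as a derivation: in the second covariant derivative, the terms with one
  derivative on each factor are symmetric in the two directions and cancel.\<close>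

lemma det_conn_curvature:
  assumes X: "X \<in> VF" and Y: "Y \<in> VF" and \<omega>: "\<omega> \<in> forms02 M" and Z: "Z \<in> HC M" and W: "W \<in> HC M"
  defines "A \<equiv> det_conn nabla"
  shows "A X (A Y \<omega>) Z W p - A Y (A X \<omega>) Z W p - A (bracket X Y) \<omega> Z W p
    = - \<omega> (cR X Y Z) W p - \<omega> Z (cR X Y W) p"
proof -
  let ?n = "cnabla nabla"
  note sm = forms02_smooth[OF \<omega>]
  have *: "A V (A V' \<omega>) Z W p = cderiv V (cderiv V' (\<omega> Z W)) p
      - cderiv V (\<omega> (?n V' Z) W) p - cderiv V (\<omega> Z (?n V' W)) p
      - (cderiv V' (\<omega> (?n V Z) W) p - \<omega> (?n V' (?n V Z)) W p - \<omega> (?n V Z) (?n V' W) p)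
      - (cderiv V' (\<omega> Z (?n V W)) p - \<omega> (?n V' Z) (?n V W) p - \<omega> Z (?n V' (?n V W)) p)"
    if V: "V \<in> VF" and V': "V' \<in> VF" for V V'
  proof -
    note s = cderiv_smooth[OF V' sm[OF Z W]] sm[OF cnabla_HC[OF V' Z] W] sm[OF Z cnabla_HC[OF V' W]]
    have "cderiv V (\<lambda>p. cderiv V' (\<omega> Z W) p - \<omega> (?n V' Z) W p - \<omega> Z (?n V' W) p) p
        = cderiv V (cderiv V' (\<omega> Z W)) p - cderiv V (\<omega> (?n V' Z) W) p - cderiv V (\<omega> Z (?n V' W)) p"
      by (simp add: cderiv_diff V s smooth_ring)
    then show ?thesis by (simp add: A_def det_conn_def)
  qed
  have B: "A (bracket X Y) \<omega> Z W p = cderiv X (cderiv Y (\<omega> Z W)) p - cderiv Y (cderiv X (\<omega> Z W)) p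
      - \<omega> (?n (bracket X Y) Z) W p - \<omega> Z (?n (bracket X Y) W) p"
    by (simp add: A_def det_conn_def cderiv_bracket)
  note HC = cnabla_HC X Y Z W bracket_vf[OF X Y] HC_closed(2)
  show ?thesis
    unfolding *[OF X Y] *[OF Y X] B cR_eq
    by (simp add: forms02_left[OF \<omega>] forms02_vsub[OF \<omega>] HC)
qed

end

context tanaka_webster_frame
begin

text \<open>Minus the trace of the curvature on the (0,1)-bundle is \<open>i rho\<close>.\<close>

lemma line_curv_eq:
  assumes p: "p \<in> U" and X: "X \<in> VF" and Y: "Y \<in> VF"
  shows "line_curv M (det_conn nabla) X Y p = \<i> * complex_of_real (rho X Y p)"
proof -
  note One_nat_def [simp del]
  let ?A = "det_conn nabla"
  have real: "\<omega> (cvf (R X Y V)) (cvf W) p + \<omega> (cvf V) (cvf (R X Y W)) p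
      = - \<i> * complex_of_real (rho X Y p) * \<omega> (cvf V) (cvf W) p"
    if \<omega>: "\<omega> \<in> forms02 M" and V: "V \<in> HF" and W: "W \<in> HF" for \<omega> V W
  proof -
    let ?a = "\<lambda>V W. \<omega> (cvf V) (cvf W) p"
    let ?b = "\<lambda>V W. ?a (R X Y V) W + ?a V (R X Y W)"
    note RH = R_HF[OF X Y]
    note Rl = R_vadd[OF X Y HF_vf HF_vf] R_vmult[OF X Y HF_vf]
    have a: "?a V W = plucker01 V W p * ?a (E 1) (E 3)" if "V \<in> HF" "W \<in> HF" for V W
      by (rule forms02_real_expand[OF p that])
        (simp_all add: cvf_HC cvf_vadd cvf_vmult forms02_vadd[OF \<omega>] forms02_vmult[OF \<omega>]
          forms02_J[OF \<omega>] smooth_of_real scaleR_conv_of_real forms02_skew[OF \<omega>, symmetric])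
    \<comment> \<open>The curvature acting on \<omega> is again of type (0,2), as R is tensorial,
      complex linear and J-compatible; hence it is a multiple of \<omega>, and the factor can be
      found on \<open>(E 1, E 3)\<close>.\<close>
    have b: "?b V W = plucker01 V W p * ?b (E 1) (E 3)"
    proof (rule forms02_real_expand[OF p V W])
      fix V W assume V: "V \<in> HF" and W: "W \<in> HF"
      show "?b V W = - ?b W V"
        using forms02_skew[OF \<omega> cvf_HC cvf_HC, OF RH[OF V] W] forms02_skew[OF \<omega> cvf_HC cvf_HC, OF V RH[OF W]]
        by simp
      show "?b (J V) W = - \<i> * ?b V W"
        using V W by (simp add: R_J[OF X Y] HF_vf forms02_J[OF \<omega>] cvf_HC RH algebra_simps)
      show "?b V (vmult h W) = h p *\<^sub>R ?b V W" if "h \<in> SF" for h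
        using V W that by (simp add: Rl cvf_HC cvf_vmult forms02_vmult[OF \<omega>] smooth_of_real
            scaleR_conv_of_real RH algebra_simps)
      show "?b V (vadd W W') = ?b V W + ?b V W'" if "W' \<in> HF" for W'
        using V W that by (simp add: Rl cvf_HC cvf_vadd forms02_vadd[OF \<omega>] RH)
    qed
    have g0: "g (R X Y (E i)) (E i) p = 0" if "i \<in> {1..4}" for i
      using g_R_skew[OF X Y HF_vf HF_vf, OF E_HF[OF that] E_HF[OF that], of p]
        g_sym[OF HF_vf HF_vf, OF RH E_HF, OF E_HF, OF that that, of p] by simp
    have "plucker01 (R X Y (E 1)) (E 3) p + plucker01 (E 1) (R X Y (E 3)) p = - \<i> * complex_of_real (rho X Y p)"
      using p g0[of 1] g0[of 3] by (simp add: plucker01_def E_g rho_def complex_eq_iff)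
    moreover have "?a (R X Y (E 1)) (E 3) = plucker01 (R X Y (E 1)) (E 3) p * ?a (E 1) (E 3)"
      "?a (E 1) (R X Y (E 3)) = plucker01 (E 1) (R X Y (E 3)) p * ?a (E 1) (E 3)"
      by (rule a; simp add: RH E_HFs)+
    ultimately have "?b (E 1) (E 3) = - \<i> * complex_of_real (rho X Y p) * ?a (E 1) (E 3)"
      by (simp only: distrib_right[symmetric])
    then show ?thesis using b a[OF V W] by (simp only: mult_ac)
  qed
  have ex: "?A X (?A Y \<omega>) Z W p - ?A Y (?A X \<omega>) Z W p - ?A (bracket X Y) \<omega> Z W p
      = \<i> * complex_of_real (rho X Y p) * \<omega> Z W p"
    if \<omega>: "\<omega> \<in> forms02 M" and Z: "Z \<in> HC M" and W: "W \<in> HC M" for \<omega> Z W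
  proof -
    have h: "re_vf Z \<in> HF" "im_vf Z \<in> HF" "re_vf W \<in> HF" "im_vf W \<in> HF"
      using Z W by (simp_all add: HC_iff)
    let ?a = "\<lambda>V W. \<omega> (cvf V) (cvf W) p" and ?R = "R X Y" and ?c = "complex_of_real (rho X Y p)"
    have "\<omega> (cR X Y Z) W p + \<omega> Z (cR X Y W) p
      = (?a (?R (re_vf Z)) (re_vf W) + ?a (re_vf Z) (?R (re_vf W)))
      - (?a (?R (im_vf Z)) (im_vf W) + ?a (im_vf Z) (?R (im_vf W)))
      + \<i> * ((?a (?R (re_vf Z)) (im_vf W) + ?a (re_vf Z) (?R (im_vf W)))
        + (?a (?R (im_vf Z)) (re_vf W) + ?a (im_vf Z) (?R (re_vf W))))"
      unfolding forms02_parts[OF \<omega> cR_HC[OF X Y Z] W] forms02_parts[OF \<omega> Z cR_HC[OF X Y W]]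
      by (simp add: cR_def algebra_simps)
    also have "\<dots> = - \<i> * ?c * \<omega> Z W p"
      unfolding real[OF \<omega> h(1,3)] real[OF \<omega> h(2,4)] real[OF \<omega> h(1,4)] real[OF \<omega> h(2,3)]
        forms02_parts[OF \<omega> Z W]
      by (simp add: algebra_simps)
    finally have "\<omega> (cR X Y Z) W p + \<omega> Z (cR X Y W) p = - \<i> * ?c * \<omega> Z W p" .
    from arg_cong[OF this, of uminus] show ?thesis
      unfolding det_conn_curvature[OF X Y \<omega> Z W] by simp
  qed
  \<comment> \<open>A form with value 1 on \<open>(E 1, E 3)\<close> at p, which makes the scalar in
    \<open>line_curv\<close> unique.\<close>
  let ?w = "\<lambda>Z W p. dual01 (E 1) Z p * dual01 (E 3) W p - dual01 (E 1) W p * dual01 (E 3) Z p"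
  have w: "?w \<in> forms02 M" by (rule dual01_wedge_forms02[OF E_HFs(1,4)])
  have w1: "?w (cvf (E 1)) (cvf (E 3)) p = 1"
    using p by (simp add: dual01_def JE E_g g_vzero HF_vf E_HFs complex_eq_iff)
  note c13 = cvf_HC[OF E_HFs(1)] cvf_HC[OF E_HFs(4)]
  show ?thesis
    unfolding line_curv_def
  proof (rule the_equality)
    show "\<forall>\<omega>\<in>forms02 M. \<forall>Z\<in>HC M. \<forall>W\<in>HC M.
        ?A X (?A Y \<omega>) Z W p - ?A Y (?A X \<omega>) Z W p - ?A (bracket X Y) \<omega> Z W p
        = \<i> * complex_of_real (rho X Y p) * \<omega> Z W p"
      using ex by blast
  next
    fix c assume c: "\<forall>\<omega>\<in>forms02 M. \<forall>Z\<in>HC M. \<forall>W\<in>HC M.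
        ?A X (?A Y \<omega>) Z W p - ?A Y (?A X \<omega>) Z W p - ?A (bracket X Y) \<omega> Z W p = c * \<omega> Z W p"
    have "c * ?w (cvf (E 1)) (cvf (E 3)) p
        = \<i> * complex_of_real (rho X Y p) * ?w (cvf (E 1)) (cvf (E 3)) p"
      by (rule trans[OF bspec[OF bspec[OF bspec[OF c w] c13(1)] c13(2), symmetric] ex[OF w c13]])
    then show "c = \<i> * complex_of_real (rho X Y p)" unfolding w1 by simp
  qed
qed

end

subsection \<open>Self-dual parts\<close>

text \<open>Laplace expansion of a 4 by 4 determinant along columns 1 and 2. In the application
  these columns are Kronecker deltas, and the complementary minors are the Pluecker coordinates of X
  and Y.\<close>

lemma sum_permutes_1_4:
  fixes A :: "nat \<Rightarrow> nat \<Rightarrow> real"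
  shows "(\<Sum>q | q permutes {1,2,3,4}. of_int (sign q) * (\<Prod>i\<in>{1,2,3,4}. A i (q i)))
    = (A 1 1 * A 2 2 - A 1 2 * A 2 1) * (A 3 3 * A 4 4 - A 3 4 * A 4 3)
    - (A 1 1 * A 3 2 - A 1 2 * A 3 1) * (A 2 3 * A 4 4 - A 2 4 * A 4 3)
    + (A 1 1 * A 4 2 - A 1 2 * A 4 1) * (A 2 3 * A 3 4 - A 2 4 * A 3 3)
    + (A 2 1 * A 3 2 - A 2 2 * A 3 1) * (A 1 3 * A 4 4 - A 1 4 * A 4 3)
    - (A 2 1 * A 4 2 - A 2 2 * A 4 1) * (A 1 3 * A 3 4 - A 1 4 * A 3 3)
    + (A 3 1 * A 4 2 - A 3 2 * A 4 1) * (A 1 3 * A 2 4 - A 1 4 * A 2 3)"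
proof -
  note One_nat_def [simp del]
  have 1: "finite {2,3,4::nat}" "1 \<notin> {2,3,4::nat}" and 2: "finite {3,4::nat}" "2 \<notin> {3,4::nat}"
    and 3: "finite {4::nat}" "3 \<notin> {4::nat}" by auto
  show ?thesis
    unfolding sum_over_permutations_insert[OF 1] sum_over_permutations_insert[OF 2]
      sum_over_permutations_insert[OF 3] permutes_sing
    by (simp add: sign_swap_id permutation_swap_id permutation_compose sign_compose sign_id
        swap_id_eq algebra_simps)
qed

lemma sum_permutes_first_column:
  fixes A :: "nat \<Rightarrow> nat \<Rightarrow> real"
  assumes A0: "A 0 0 = 1" "\<And>i. i \<in> {1,2,3,4} \<Longrightarrow> A i 0 = 0"
  shows "(\<Sum>q | q permutes {..<5}. of_int (sign q) * (\<Prod>i<5. A i (q i)))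
    = (\<Sum>q | q permutes {1,2,3,4}. of_int (sign q) * (\<Prod>i\<in>{1,2,3,4}. A i (q i)))"
proof -
  let ?S = "{1,2,3,4::nat}"
  have S: "{..<5} = insert 0 ?S" "finite ?S" "0 \<notin> ?S" by auto
  let ?f = "\<lambda>q. of_int (sign q) * (\<Prod>i\<in>insert 0 ?S. A i (q i))"
  have "(\<Sum>q | q permutes insert 0 ?S. ?f q)
      = (\<Sum>b\<in>insert 0 ?S. \<Sum>q | q permutes ?S. ?f (Transposition.transpose 0 b \<circ> q))"
    by (rule sum_over_permutations_insert[OF S(2,3)])
  also have "\<dots> = (\<Sum>q | q permutes ?S. ?f (Transposition.transpose 0 0 \<circ> q))
      + (\<Sum>b\<in>?S. \<Sum>q | q permutes ?S. ?f (Transposition.transpose 0 b \<circ> q))"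
    by (rule sum.insert[OF S(2,3)])
  also have "(\<Sum>b\<in>?S. \<Sum>q | q permutes ?S. ?f (Transposition.transpose 0 b \<circ> q)) = 0"
  proof (intro sum.neutral ballI)
    fix b q assume b: "b \<in> ?S" and "q \<in> {q. q permutes ?S}"
    then have q: "q permutes ?S" by simp
    \<comment> \<open>The composed permutation sends this \<open>i\<close> to 0, so the product
      contains the vanishing entry \<open>A i 0\<close>.\<close>
    obtain i where i: "i \<in> ?S" "q i = b" using permutes_image[OF q] b by (metis imageE)
    then have "A i ((Transposition.transpose 0 b \<circ> q) i) = 0" using A0(2)[OF i(1)] by simp
    then have "(\<Prod>i\<in>insert 0 ?S. A i ((Transposition.transpose 0 b \<circ> q) i)) = 0"
      using i(1) by (intro prod_zero) blast+
    then show "?f (Transposition.transpose 0 b \<circ> q) = 0" by simp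
  qed
  also have "(\<Sum>q | q permutes ?S. ?f (Transposition.transpose 0 0 \<circ> q))
      = (\<Sum>q | q permutes ?S. of_int (sign q) * (\<Prod>i\<in>?S. A i (q i)))"
  proof (rule sum.cong[OF refl])
    fix q assume "q \<in> {q. q permutes ?S}"
    then have "q 0 = 0" using S(3) by (simp add: permutes_def)
    then show "?f (Transposition.transpose 0 0 \<circ> q)
        = of_int (sign q) * (\<Prod>i\<in>?S. A i (q i))"
      unfolding prod.insert[OF S(2,3)] by (simp add: A0(1))
  qed
  finally show ?thesis unfolding S(1) by simp
qed

section \<open>The Hodge star and self-dual parts in an adapted frame\<close>

context contact_frame
begin

definition plucker :: "'a vf \<Rightarrow> 'a vf \<Rightarrow> nat \<Rightarrow> nat \<Rightarrow> 'a \<Rightarrow> real" where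
  "plucker X Y i j p = g X (E i) p * g Y (E j) p - g X (E j) p * g Y (E i) p"

lemma skew_expand:
  fixes b :: "'a vf \<Rightarrow> 'a vf \<Rightarrow> real"
  assumes p: "p \<in> U" and X: "X \<in> HF" and Y: "Y \<in> HF"
    and skew: "\<And>X Y. X \<in> HF \<Longrightarrow> Y \<in> HF \<Longrightarrow> b X Y = - b Y X"
    and add: "\<And>X Y Z. X \<in> HF \<Longrightarrow> Y \<in> HF \<Longrightarrow> Z \<in> HF \<Longrightarrow> b (vadd X Y) Z = b X Z + b Y Z"
    and mult: "\<And>X Y h. X \<in> HF \<Longrightarrow> Y \<in> HF \<Longrightarrow> h \<in> SF \<Longrightarrow> b (vmult h X) Y = h p * b X Y"
  shows "b X Y = plucker X Y 1 2 p * b (E 1) (E 2) + plucker X Y 1 3 p * b (E 1) (E 3)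
    + plucker X Y 1 4 p * b (E 1) (E 4) + plucker X Y 2 3 p * b (E 2) (E 3)
    + plucker X Y 2 4 p * b (E 2) (E 4) + plucker X Y 3 4 p * b (E 3) (E 4)"
proof -
  note One_nat_def [simp del]
  have ex: "b X Y = (\<Sum>i=1..4. g X (E i) p *\<^sub>R b (E i) Y)" if "X \<in> HF" "Y \<in> HF" for X Y
    by (rule tensor_expand[OF p that(1)]) (use that in \<open>simp_all add: add mult\<close>)
  have exr: "b (E j) Y = - (\<Sum>i=1..4. g Y (E i) p *\<^sub>R b (E i) (E j))" if "j \<in> {1..4}" for j
    using skew[OF E_HF[OF that] Y] ex[OF Y E_HF[OF that]] by simp
  have d: "b (E j) (E j) = 0" if "j \<in> {1..4}" for j
    using skew[OF E_HF[OF that] E_HF[OF that]] by simp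
  have s: "b (E 2) (E 1) = - b (E 1) (E 2)" "b (E 3) (E 1) = - b (E 1) (E 3)"
    "b (E 4) (E 1) = - b (E 1) (E 4)" "b (E 3) (E 2) = - b (E 2) (E 3)"
    "b (E 4) (E 2) = - b (E 2) (E 4)" "b (E 4) (E 3) = - b (E 3) (E 4)"
    by (intro skew E_HFs)+
  show ?thesis
    unfolding ex[OF X Y] sum_1_4
    by (simp add: exr sum_1_4 d s plucker_def algebra_simps)
qed

text \<open>The first argument is the Reeb field, so column 0 of the matrix of inner products is (1,
  0, 0, 0, 0) and the determinant drops to size four. Its remaining rows pair with horizontal
  vectors, so \<open>X\<close> and \<open>Y\<close> need not be projected.\<close>

lemma vol_form_frame:
  assumes p: "p \<in> U" and b: "b \<in> {1..4}" and c: "c \<in> {1..4}" and X: "X \<in> VF" and Y: "Y \<in> VF"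
  defines "\<delta> \<equiv> \<lambda>i j. if i = j then 1 else 0 :: real"
  shows "vol_form M E [E 0, E b, E c, X, Y] p
    = (\<delta> 1 b * \<delta> 2 c - \<delta> 1 c * \<delta> 2 b) * plucker X Y 3 4 p
    - (\<delta> 1 b * \<delta> 3 c - \<delta> 1 c * \<delta> 3 b) * plucker X Y 2 4 p
    + (\<delta> 1 b * \<delta> 4 c - \<delta> 1 c * \<delta> 4 b) * plucker X Y 2 3 p
    + (\<delta> 2 b * \<delta> 3 c - \<delta> 2 c * \<delta> 3 b) * plucker X Y 1 4 p
    - (\<delta> 2 b * \<delta> 4 c - \<delta> 2 c * \<delta> 4 b) * plucker X Y 1 3 p
    + (\<delta> 3 b * \<delta> 4 c - \<delta> 3 c * \<delta> 4 b) * plucker X Y 1 2 p"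
proof -
  note One_nat_def [simp del]
  define A where "A = (\<lambda>i j. g (E i) ([E 0, E b, E c, X, Y] ! j) p)"
  have A00: "A 0 0 = 1" by (simp add: A_def E_0 g_reeb reeb_vf eta_reeb)
  have A0: "A i 0 = 0" if "i \<in> {1,2,3,4}" for i
    using that E_HF[of i] by (auto simp: A_def E_0 g_reeb HF_vf eta_HF)
  have A: "A i 1 = \<delta> i b" "A i 2 = \<delta> i c" "A i 3 = g X (E i) p" "A i 4 = g Y (E i) p"
    if "i \<in> {1..4}" for i
    using that p b c X Y E_HF[OF that]
    by (simp_all add: A_def E_orth \<delta>_def g_sym[OF HF_vf] One_nat_def numeral_eq_Suc)
  have "vol_form M E [E 0, E b, E c, X, Y] p
      = (\<Sum>q | q permutes {..<5}. of_int (sign q) * (\<Prod>i<5. A i (q i)))"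
    by (simp only: vol_form_def A_def)
  also note sum_permutes_first_column[where A=A, OF A00 A0]
  also note sum_permutes_1_4
  finally show ?thesis by (simp add: A plucker_def mult.commute)
qed

text \<open>The wedge of \<eta> with a horizontal form vanishes on three horizontal vectors, so only
  triples starting with \<open>E 0\<close> survive. The star exchanges 12 with 34, 14 with 23, and
  13 with minus 24.\<close>

lemma star_frame:
  fixes \<beta> :: "'a vf \<Rightarrow> 'a vf \<Rightarrow> 'a \<Rightarrow> complex"
  assumes p: "p \<in> U" and X: "X \<in> VF" and Y: "Y \<in> VF"
  shows "star M E (hpart M \<beta>) X Y p = \<beta> (E 1) (E 2) p * plucker X Y 3 4 p
    - \<beta> (E 1) (E 3) p * plucker X Y 2 4 p + \<beta> (E 1) (E 4) p * plucker X Y 2 3 p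
    + \<beta> (E 2) (E 3) p * plucker X Y 1 4 p - \<beta> (E 2) (E 4) p * plucker X Y 1 3 p
    + \<beta> (E 3) (E 4) p * plucker X Y 1 2 p"
proof -
  note One_nat_def [simp del]
  have l: "{..<5::nat} = {0,1,2,3,4}" "{..<4::nat} = {0,1,2,3}" "{..<3::nat} = {0,1,2}"
    "{..<2::nat} = {0,1}" "{..<1::nat} = {0}" by auto
  have w0: "eta_wedge M (hpart M \<beta>) (E 0) (E b) (E c) p = \<beta> (E b) (E c) p"
    if "b \<in> {1..4}" "c \<in> {1..4}" for b c
    using that by (simp add: eta_wedge_def hpart_def E_0 eta_reeb eta_HF E_HF hproj_id)
  have w1: "eta_wedge M (hpart M \<beta>) (E a) (E b) (E c) p = 0"
    if "a \<in> {1..4}" "b \<in> {1..4}" "c \<in> {1..4}" for a b c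
    using that by (simp add: eta_wedge_def eta_HF E_HF)
  show ?thesis
    unfolding star_def hodge3_def l
    by (simp add: l w0 w1 vol_form_frame[OF p _ _ X Y])
qed

text \<open>The three summands belong to the basis e12 + e34, e13 - e24, e14 + e23 of self-dual
  forms. An abstract \<open>b\<close> covers both uses, the Ricci form and a multiple of
  d\<eta>.\<close>

lemma selfdual_part_frame:
  fixes \<beta> :: "'a vf \<Rightarrow> 'a vf \<Rightarrow> 'a \<Rightarrow> complex" and b :: "'a vf \<Rightarrow> 'a vf \<Rightarrow> real"
  assumes p: "p \<in> U" and X: "X \<in> VF" and Y: "Y \<in> VF"
    and \<beta>: "\<And>X Y. X \<in> HF \<Longrightarrow> Y \<in> HF \<Longrightarrow> \<beta> X Y p = \<i> * complex_of_real (b X Y)"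
    and skew: "\<And>X Y. X \<in> HF \<Longrightarrow> Y \<in> HF \<Longrightarrow> b X Y = - b Y X"
    and add: "\<And>X Y Z. X \<in> HF \<Longrightarrow> Y \<in> HF \<Longrightarrow> Z \<in> HF \<Longrightarrow> b (vadd X Y) Z = b X Z + b Y Z"
    and mult: "\<And>X Y h. X \<in> HF \<Longrightarrow> Y \<in> HF \<Longrightarrow> h \<in> SF \<Longrightarrow> b (vmult h X) Y = h p * b X Y"
  shows "selfdual_part M E \<beta> X Y p = \<i> / 2 * complex_of_real (
      (b (E 1) (E 2) + b (E 3) (E 4)) * (plucker X Y 1 2 p + plucker X Y 3 4 p)
    + (b (E 1) (E 3) - b (E 2) (E 4)) * (plucker X Y 1 3 p - plucker X Y 2 4 p)
    + (b (E 1) (E 4) + b (E 2) (E 3)) * (plucker X Y 1 4 p + plucker X Y 2 3 p))"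
proof -
  note One_nat_def [simp del]
  note h = hproj_HF[OF X] hproj_HF[OF Y]
  have m: "plucker (hproj M X) (hproj M Y) i j p = plucker X Y i j p" if "i \<in> {1..4}" "j \<in> {1..4}" for i j
    using that by (simp add: plucker_def g_hproj X Y E_HF)
  have "hpart M \<beta> X Y p = \<i> * complex_of_real (b (hproj M X) (hproj M Y))"
    by (simp add: hpart_def \<beta> h)
  also note skew_expand[where b=b, OF p h skew add mult]
  finally show ?thesis
    unfolding selfdual_part_def star_frame[OF p X Y]
    by (simp add: \<beta> E_HFs m field_simps)
qed

end

subsection \<open>The Seiberg-Witten like equations\<close>

lemma cderiv_const: "X \<in> vector_fields M \<Longrightarrow> cderiv X (\<lambda>p. c) = (\<lambda>p. 0)"
  by (simp add: cderiv_def fun_eq_iff vf_const complex_eq_iff)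

context tanaka_webster_manifold
begin

lemma constant_spinor_field: "sp_scale (\<lambda>p. k) unit_spinor \<in> spinor_fields M"
  by (simp add: spinor_fields_def sp_scale_def unit_spinor_def smooth_const forms01_def forms02_def
      clinear_on_HC_def)

lemma dirac_constant_spinor:
  assumes "\<And>i. i \<in> {1..4} \<Longrightarrow> E i \<in> HF"
  shows "sp_zero_at M (dirac M nabla E (sp_scale (\<lambda>p. k) unit_spinor)) p"
proof -
  have z: "spin_conn nabla V (sp_scale (\<lambda>p. k) unit_spinor)
      = \<lparr>sp0 = \<lambda>p. 0, sp1 = \<lambda>Z p. 0, sp2 = \<lambda>Z W p. 0\<rparr>" if "V \<in> VF" for V
    using that by (simp add: spin_conn_def sp_scale_def unit_spinor_def conn01_def det_conn_def
        cderiv_const)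
  have "E 1 \<in> VF" "E 2 \<in> VF" "E 3 \<in> VF" "E 4 \<in> VF" by (intro HF_vf assms; simp)+
  then show ?thesis
    by (simp add: dirac_def Let_def z reeb_vf clifford_def sp_add_def sp_zero_at_def)
qed

text \<open>The product with a multiple of \<open>unit_spinor\<close> sees only degree 0, where X Y
  \<psi> is - 2k times the pairing of the (1,0)-part of Y with the (0,1)-part of X. The real part of
  that pairing is half of g(X, Y) and cancels against the metric term of \<sigma>.\<close>

lemma sigma_constant_spinor:
  assumes X: "X \<in> HF" and Y: "Y \<in> HF"
  shows "sigma_form M E (sp_scale (\<lambda>p. complex_of_real k) unit_spinor) X Y p
    = \<i> * complex_of_real (- k\<^sup>2 * deta M X Y p)"
proof -
  let ?\<psi> = "sp_scale (\<lambda>p. complex_of_real k) unit_spinor"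
  have c: "cmetric M (part10 M Y) (part01 M X) p = (g X Y p + \<i> * deta M X Y p) / 2"
    using X Y g_J_left[OF Y X, of p]
    by (simp add: cmetric_def part10_def part01_def hproj_id g_simps vf_closed HF_vf J_HF
        smooth_const g_J deta_g g_sym[of Y X] g_sym[of Y "J X"] complex_eq_iff field_simps)
  have sqrt2: "complex_of_real (sqrt 2) * (complex_of_real (sqrt 2) * z) = 2 * z" for z
    by (simp flip: mult.assoc of_real_mult)
  have sp0: "sp0 (clifford M X (clifford M Y ?\<psi>)) p
      = - complex_of_real k * (g X Y p + \<i> * deta M X Y p)"
    by (simp add: clifford_def sp_scale_def unit_spinor_def eta_HF X Y c sqrt2
        mult.left_commute[of "complex_of_real k"])
  have inner: "sp_inner E \<phi> ?\<psi> p = sp0 \<phi> p * complex_of_real k" for \<phi>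
    by (simp add: sp_inner_def sp_scale_def unit_spinor_def)
  have psi: "sp0 ?\<psi> p = complex_of_real k"
    by (simp add: sp_scale_def unit_spinor_def)
  show ?thesis
    unfolding sigma_form_def inner sp0 psi by (simp add: power2_eq_square algebra_simps)
qed

end

context tanaka_webster_frame
begin

lemma selfdual_curvature:
  assumes p: "p \<in> U" and X: "X \<in> VF" and Y: "Y \<in> VF" and s: "has_scalar_curvature M nabla s"
  shows "selfdual_part M E (line_curv M (det_conn nabla)) X Y p
    = - \<i> / 4 * complex_of_real (s p * (plucker X Y 1 2 p + plucker X Y 3 4 p))"
proof -
  note One_nat_def [simp del]
  have "selfdual_part M E (line_curv M (det_conn nabla)) X Y p = \<i> / 2 * complex_of_real (
      (rho (E 1) (E 2) p + rho (E 3) (E 4) p) * (plucker X Y 1 2 p + plucker X Y 3 4 p)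
    + (rho (E 1) (E 3) p - rho (E 2) (E 4) p) * (plucker X Y 1 3 p - plucker X Y 2 4 p)
    + (rho (E 1) (E 4) p + rho (E 2) (E 3) p) * (plucker X Y 1 4 p + plucker X Y 2 3 p))"
  proof (rule selfdual_part_frame[OF p X Y])
    fix X Y assume X: "X \<in> HF" and Y: "Y \<in> HF"
    note vf = HF_vf[OF X] HF_vf[OF Y] HF_vf[OF E_HFs(1)] HF_vf[OF E_HFs(3)] HF_vf[OF E_HFs(4)]
      HF_vf[OF E_HFs(5)]
    show "line_curv M (det_conn nabla) X Y p = \<i> * complex_of_real (rho X Y p)"
      by (rule line_curv_eq[OF p vf(1,2)])
    show "rho X Y p = - rho Y X p"
      unfolding rho_def R_swap[OF vf(1,2,3)] R_swap[OF vf(1,2,5)]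
      by (simp add: g_simps R_vf vf smooth_const)
    show "rho (vmult h X) Y p = h p * rho X Y p" if "h \<in> SF" for h
      by (simp add: rho_def R_vmult_left g_simps R_vf vf that algebra_simps)
    show "rho (vadd X Z) Y p = rho X Y p + rho Z Y p" if "Z \<in> HF" for Z
      by (simp add: rho_def R_vadd_left g_simps R_vf vf HF_vf[OF that])
  qed
  \<comment> \<open>J-invariance removes the coefficients of e13 - e24 and e14 + e23.\<close>
  then show ?thesis
    unfolding rho_frame[OF p s] by simp
qed

lemma selfdual_sigma:
  assumes p: "p \<in> U" and X: "X \<in> VF" and Y: "Y \<in> VF"
  shows "selfdual_part M E (sigma_form M E (sp_scale (\<lambda>p. complex_of_real k) unit_spinor)) X Y p
    = - \<i> * complex_of_real (k\<^sup>2 * (plucker X Y 1 2 p + plucker X Y 3 4 p))"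
proof -
  note One_nat_def [simp del]
  let ?b = "\<lambda>X Y. - k\<^sup>2 * deta M X Y p"
  have "selfdual_part M E (sigma_form M E (sp_scale (\<lambda>p. complex_of_real k) unit_spinor)) X Y p
    = \<i> / 2 * complex_of_real (
      (?b (E 1) (E 2) + ?b (E 3) (E 4)) * (plucker X Y 1 2 p + plucker X Y 3 4 p)
    + (?b (E 1) (E 3) - ?b (E 2) (E 4)) * (plucker X Y 1 3 p - plucker X Y 2 4 p)
    + (?b (E 1) (E 4) + ?b (E 2) (E 3)) * (plucker X Y 1 4 p + plucker X Y 2 3 p))"
  proof (rule selfdual_part_frame[OF p X Y])
    fix X Y assume X: "X \<in> HF" and Y: "Y \<in> HF"
    show "sigma_form M E (sp_scale (\<lambda>p. complex_of_real k) unit_spinor) X Y p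
        = \<i> * complex_of_real (?b X Y)"
      by (rule sigma_constant_spinor[OF X Y])
    show "?b X Y = - ?b Y X" using deta_skew[OF X Y] by simp
    show "?b (vmult h X) Y = h p * ?b X Y" if "h \<in> SF" for h
      using that X Y by (simp add: deta_g HF_closed J_vmult HF_vf g_simps J_vf)
    show "?b (vadd X Z) Y = ?b X Y + ?b Z Y" if "Z \<in> HF" for Z
      using that X Y by (simp add: deta_g HF_closed J_vadd HF_vf g_simps J_vf algebra_simps)
  qed
  \<comment> \<open>That is, d\<eta> = e12 + e34 on H, which is already self-dual.\<close>
  moreover have "deta M (E 1) (E 2) p = 1" "deta M (E 3) (E 4) p = 1" "deta M (E 1) (E 3) p = 0"
    "deta M (E 1) (E 4) p = 0" "deta M (E 2) (E 3) p = 0" "deta M (E 2) (E 4) p = 0"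
    using p by (simp_all add: deta_g E_HFs JE E_g g_simps HF_vf vzero_vf)
  ultimately show ?thesis by (simp add: algebra_simps)
qed

end

theorem mainTheorem1:
  fixes M :: "'a::{t2_space,second_countable_topology} contact_data"
    and nabla :: "'a connection"
    and s :: "'a \<Rightarrow> real"
  assumes "strictly_pseudoconvex_CR M"
    and "tanaka_webster M nabla"
    and "has_scalar_curvature M nabla s"
    and "\<exists>c<0. \<forall>p. s p = c"
  shows "seiberg_witten_solution M nabla
    (sp_scale (\<lambda>p. complex_of_real (sqrt (- s p))) unit_spinor)"
proof -
  interpret tanaka_webster_manifold M nabla
    using assms(1,2) by unfold_locales (simp_all add: strictly_pseudoconvex_CR_def)
  obtain c where c: "c < 0" and s: "\<And>p. s p = c" using assms(4) by blast
  show ?thesis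
    unfolding seiberg_witten_solution_def s
  proof (intro conjI constant_spinor_field allI impI ballI)
    fix U E p X Y
    assume E: "adapted_frame M U E" and p: "p \<in> U"
    interpret tanaka_webster_frame M U E nabla by unfold_locales (rule E)
    show "sp_zero_at M (dirac M nabla E (sp_scale (\<lambda>p. complex_of_real (sqrt (- c))) unit_spinor)) p"
      by (rule dirac_constant_spinor[OF E_HF])
    assume "X \<in> VF" "Y \<in> VF"
    \<comment> \<open>As c is negative, the square of \<open>sqrt (- c)\<close> is
      \<open>- c\<close>, which matches the two coefficients.\<close>
    then show "selfdual_part M E (line_curv M (det_conn nabla)) X Y p = - (1 / 4) *
        selfdual_part M E (sigma_form M E (sp_scale (\<lambda>p. complex_of_real (sqrt (- c))) unit_spinor)) X Y p"
      using c by (simp add: selfdual_curvature[OF p _ _ assms(3)] selfdual_sigma[OF p] s)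
  qed
qed

end
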